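(* Let $(\boldsymbol{\theta}_n)_{n\ge 0}$ be a (possibly inexact) output of block majorization-minimization with trust-region radii $(r_n)_{n\ge1}$ (BMM-DR, defined in the context), and assume conditions A1, A2, A3, A4 of the context. Then the following hold. (i) (Rate of convergence) There exist constants $M,c>0$ such that for all $n\ge 2$, $$\min_{1\le k\le n}\ \Big[\sup_{\boldsymbol{\theta}\in\boldsymbol{\Theta},\ \|\boldsymbol{\theta}-\boldsymbol{\theta}_k\|\le 1}\widetilde V(\boldsymbol{\theta}_k,\boldsymbol{\theta})\Big]\ \le\ c\,\frac{M+L_g+\big(\rho^{-1}\wedge\sum_{k=1}^n r_k^2\big)}{(\sqrt n/\log n)\wedge\sum_{k=1}^n r_k},$$ where $a\wedge b=\min(a,b)$, $\rho^{-1}:=\infty$ if $\rho=0$, and sums of infinite radii are $\infty$. (ii) (Worst-case iteration complexity) Let $N_\varepsilon$ be the worst-case iteration complexity of the algorithm, i.e. the worst-case (with respect to the initialization $\boldsymbol{\theta}_0$) number of iterations that guarantees an $\varepsilon$-approximate stationary-Nash point of $F$ over $\boldsymbol{\Theta}$. If $r_n\equiv\infty$, then $N_\varepsilon=O\big((1+L_g+\rho^{-1})\,\varepsilon^{-2}(\log\varepsilon^{-1})^2\big)$. If $r_n=1/(\sqrt n\log n)$ for $n\ge 2$ (with $r_1\in(0,\infty)$ arbitrary), then the iteration complexity improves to $N_\varepsilon=O\big((1+L_g)\,\varepsilon^{-2}(\log\varepsilon^{-1})^2\big)$. (iii) (Asymptotic stationarity) Assume further that $\sum_{n=1}^\infty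 r_n=\infty$. Then $(\boldsymbol{\theta}_n)_{n\ge1}$ converges to the set of stationary-Nash points of $F$ over $\boldsymbol{\Theta}$. In particular, if $p$ is block-separable, i.e. $p(\theta^{(1)},\dots,\theta^{(m)})=\sum_{i=1}^m p_i(\theta^{(i)})$ with each $p_i$ convex, then $(\boldsymbol{\theta}_n)_{n\ge1}$ converges to the set of stationary points of $F$ over $\boldsymbol{\Theta}$.
   Context: Setting. $\mathcal E=\mathbb R^{I_1}\times\dots\times\mathbb R^{I_m}$ with Euclidean norm; $\boldsymbol{\Theta}=\Theta^{(1)}\times\dots\times\Theta^{(m)}$ with $\Theta^{(i)}\subseteq\mathbb R^{I_i}$; $F=f+p$ with $f$ continuously differentiable (possibly nonconvex) and $p$ continuous and convex (possibly nonsmooth). A point is written $\boldsymbol{\theta}=[\theta^{(1)},\dots,\theta^{(m)}]$. Algorithm (BMM-DR, possibly inexact). Fix radii $r_n\in(0,\infty]$, $n\ge1$, and $\boldsymbol{\theta}_0\in\boldsymbol{\Theta}$. For $n\ge1$ and, successively, $i=1,\dots,m$, set $f_n^{(i)}(\theta)=f(\theta_n^{(1)},\dots,\theta_n^{(i-1)},\theta,\theta_{n-1}^{(i+1)},\dots,\theta_{n-1}^{(m)})$ and $p_n^{(i)}(\theta)=p(\theta_n^{(1)},\dots,\theta_n^{(i-1)},\theta,\theta_{n-1}^{(i+1)},\dots,\theta_{n-1}^{(m)})$. Choose a differentiable majorizing surrogate $g_n^{(i)}$ of $f_n^{(i)}$ at $\theta_{n-1}^{(i)}$: $g_n^{(i)}\ge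 f_n^{(i)}$ on $\Theta^{(i)}$, $g_n^{(i)}(\theta_{n-1}^{(i)})=f_n^{(i)}(\theta_{n-1}^{(i)})$, $\nabla g_n^{(i)}(\theta_{n-1}^{(i)})=\nabla f_n^{(i)}(\theta_{n-1}^{(i)})$, and $g_n^{(i)}$ is $\rho$-strongly convex on $\Theta^{(i)}$ for some $\rho\ge0$ independent of $n,i$ ($\rho=0$ means convex). Put $G_n^{(i)}=g_n^{(i)}+p_n^{(i)}$ and $\Theta_n^{(i)}=\{\theta\in\Theta^{(i)}:\|\theta-\theta_{n-1}^{(i)}\|\le r_n\}$. The update $\theta_n^{(i)}$ is a point of $\Theta_n^{(i)}$ (an exact or approximate minimizer of $G_n^{(i)}$ over $\Theta_n^{(i)}$). Let $\theta_n^{(i\star)}\in\arg\min_{\theta\in\Theta_n^{(i)}}G_n^{(i)}(\theta)$ and $\Delta_n=\max_{1\le i\le m}\big(G_n^{(i)}(\theta_n^{(i)})-G_n^{(i)}(\theta_n^{(i\star)})\big)$ (optimality gap). Then $\boldsymbol{\theta}_n=[\theta_n^{(1)},\dots,\theta_n^{(m)}]$. Stationarity. Define $$\widetilde V(\boldsymbol{\theta}^*,\boldsymbol{\theta})=\langle-\nabla f(\boldsymbol{\theta}^* ),\boldsymbol{\theta}-\boldsymbol{\theta}^*\rangle+\sum_{i=1}^m\Big(p(\boldsymbol{\theta}^* )-p(\boldsymbol{\theta}^{*}[i\leftarrow\theta^{(i)}])\Big),$$ where $\boldsymbol{\theta}^*[i\leftarrow\theta^{(i)}]$ is $\boldsymbol{\theta}^*$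 with its $i$-th block replaced by the $i$-th block of $\boldsymbol{\theta}$. A point $\boldsymbol{\theta}^*\in\boldsymbol{\Theta}$ is stationary-Nash (resp. $\varepsilon$-approximate stationary-Nash) for $F$ over $\boldsymbol{\Theta}$ if $\sup_{\boldsymbol{\theta}\in\boldsymbol{\Theta},\|\boldsymbol{\theta}-\boldsymbol{\theta}^*\|\le1}\widetilde V(\boldsymbol{\theta}^*,\boldsymbol{\theta})\le0$ (resp. $\le\varepsilon$). It is stationary if $\sup_{\boldsymbol{\theta}\in\boldsymbol{\Theta},\|\boldsymbol{\theta}-\boldsymbol{\theta}^*\|\le1}\big[\langle-\nabla f(\boldsymbol{\theta}^* ),\boldsymbol{\theta}-\boldsymbol{\theta}^*\rangle+p(\boldsymbol{\theta}^* )-p(\boldsymbol{\theta})\big]\le0$. Assumptions. A1: each $\Theta^{(i)}$ is nonempty, closed and convex (not necessarily compact). A2: $f$ is continuously differentiable and $p$ is convex; for each compact $\boldsymbol{\Theta}_0\subseteq\boldsymbol{\Theta}$ there is $L=L(\boldsymbol{\Theta}_0)$ with $\|\nabla f(x)-\nabla f(y)\|\le L\|x-y\|$ and $|p(x)-p(y)|\le L\|x-y\|$ for $x,y\in\boldsymbol{\Theta}_0$; $F^*:=\inf_{\boldsymbol{\Theta}}F>-\infty$; the sub-level sets $\{\boldsymbol{\theta}\in\boldsymbol{\Theta}:F(\boldsymbol{\theta})\le a\}$, $a\in\mathbb R$, are compact. A3: there is $L_g>0$ such that for all $n,i$, $\|\nabla g_n^{(i)}(\theta)-\nabla g_n^{(i)}(\theta')\|\le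 L_g\|\theta-\theta'\|$ for $\theta,\theta'\in\Theta^{(i)}$; all $g_n^{(i)}$ are $\rho$-strongly convex for some $\rho\ge0$ (allowing $\rho=0$); and either (a) $\sum_{n\ge1}r_n^2<\infty$ and $r_{n+1}/r_n=O(1)$, or (b) $r_n\equiv\infty$ and $\rho>0$. A4: $\sum_{n\ge1}\Delta_n<\infty$.
   Formalization: In (ii) the worst case is over initializations in an arbitrary compact subset K of Θ (K=Θ if Θ is compact) and over runs with ΣΔ_n ≤ D for an arbitrary fixed D; over all of a noncompact Θ the claim fails, e.g. f(x)=√(1+x²) on ℝ with g_n=f+(x−x_{n−1})²/2. *)

theory Defs
  imports "HOL-Analysis.Analysis" "HOL-Library.Landau_Symbols"
begin

text \<open>
  The product of Euclidean spaces of (possibly different) dimensions, indexed by i = 1, ..., m, is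
  the space of vectors over a finite coordinate type, together with a map blk that sends every
  coordinate to the number of its block. The i-th factor is the coordinate subspace of the vectors
  supported in block i; its Euclidean norm is the restriction of the norm of the whole space. The
  order of the blocks matters, because the algorithm updates them successively.
\<close>

definition block_space :: "('n::finite \<Rightarrow> nat) \<Rightarrow> nat \<Rightarrow> (real ^ 'n) set" where
  "block_space blk i = {x. \<forall>j. blk j \<noteq> i \<longrightarrow> x $ j = 0}"

definition block :: "('n::finite \<Rightarrow> nat) \<Rightarrow> nat \<Rightarrow> real ^ 'n \<Rightarrow> real ^ 'n" where
  "block blk i x = (\<chi> j. if blk j = i then x $ j else 0)"

definition block_upd ::
    "('n::finite \<Rightarrow> nat) \<Rightarrow> real ^ 'n \<Rightarrow> nat \<Rightarrow> real ^ 'n \<Rightarrow> real ^ 'n" where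
  "block_upd blk x i y = (\<chi> j. if blk j = i then y $ j else x $ j)"

definition prod_set ::
    "('n::finite \<Rightarrow> nat) \<Rightarrow> nat \<Rightarrow> (nat \<Rightarrow> (real ^ 'n) set) \<Rightarrow> (real ^ 'n) set" where
  "prod_set blk m T = {x. \<forall>i\<in>{1..m}. block blk i x \<in> T i}"

text \<open>
  Gradient of a function on the Euclidean space given by a subspace S (all of the space or a block
  space), for functions that are differentiable within S at the point of S in question.
\<close>

definition grad :: "(real ^ 'n::finite) set \<Rightarrow> (real ^ 'n \<Rightarrow> real) \<Rightarrow> real ^ 'n \<Rightarrow> real ^ 'n" where
  "grad S h x = (THE v. v \<in> S \<and> (h has_derivative (\<lambda>d. v \<bullet> d)) (at x within S))"

lemma grad_eqI:
  assumes S: "subspace S" "x \<in> S" and v: "v \<in> S" "(h has_derivative (\<lambda>d. v \<bullet> d)) (at x within S)"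
  shows "grad S h x = v"
  unfolding grad_def
proof (rule the_equality)
  fix w assume w: "w \<in> S \<and> (h has_derivative (\<lambda>d. w \<bullet> d)) (at x within S)"
  have dir: "w \<bullet> d = v \<bullet> d" if "d \<in> S" for d
  proof -
    have line: "((\<lambda>t::real. x + t *\<^sub>R d) has_derivative (\<lambda>t. t *\<^sub>R d)) (at 0)"
      by (auto intro!: derivative_eq_intros)
    have sub: "(\<lambda>t::real. x + t *\<^sub>R d) ` UNIV \<subseteq> S"
      using S that by (auto intro: subspace_add subspace_scale)
    have D: "((\<lambda>t. h (x + t *\<^sub>R d)) has_derivative (\<lambda>t. u \<bullet> (t *\<^sub>R d))) (at 0)"
      if "(h has_derivative (\<lambda>d. u \<bullet> d)) (at x within S)" for u
      using has_derivative_in_compose2[of S h "\<lambda>y d. u \<bullet> d" "\<lambda>t::real. x + t *\<^sub>R d" UNIV 0]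
        has_derivative_in_compose[OF line, of h "\<lambda>d. u \<bullet> d"]
        has_derivative_subset[OF that sub] by simp
    from has_derivative_unique[OF D D] w v(2)
    have "(\<lambda>t::real. w \<bullet> (t *\<^sub>R d)) = (\<lambda>t. v \<bullet> (t *\<^sub>R d))" by blast
    from fun_cong[OF this, of 1] show ?thesis by simp
  qed
  have "w - v \<in> S" using w v(1) S(1) by (auto intro: subspace_diff)
  from dir[OF this] have "(w - v) \<bullet> (w - v) = 0" by (simp add: inner_diff_left)
  then show "w = v" by simp
qed (use v in simp)

text \<open>For \<open>\<rho> = 0\<close> this is convexity.\<close>

definition strongly_convex_on :: "('a::real_inner) set \<Rightarrow> real \<Rightarrow> ('a \<Rightarrow> real) \<Rightarrow> bool" where
  "strongly_convex_on S \<rho> h \<longleftrightarrow> convex_on S (\<lambda>x. h x - \<rho> / 2 * (norm x)\<^sup>2)"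


section \<open>Stationarity\<close>

definition V_tilde :: "('n::finite \<Rightarrow> nat) \<Rightarrow> nat \<Rightarrow> (real ^ 'n \<Rightarrow> real) \<Rightarrow> (real ^ 'n \<Rightarrow> real) \<Rightarrow>
    real ^ 'n \<Rightarrow> real ^ 'n \<Rightarrow> real" where
  "V_tilde blk m f p x y =
     (- grad UNIV f x) \<bullet> (y - x) + (\<Sum>i=1..m. p x - p (block_upd blk x i y))"

definition nash_gap :: "('n::finite \<Rightarrow> nat) \<Rightarrow> nat \<Rightarrow> (nat \<Rightarrow> (real ^ 'n) set) \<Rightarrow>
    (real ^ 'n \<Rightarrow> real) \<Rightarrow> (real ^ 'n \<Rightarrow> real) \<Rightarrow> real ^ 'n \<Rightarrow> ereal" where
  "nash_gap blk m T f p x =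
     (SUP y \<in> {y \<in> prod_set blk m T. norm (y - x) \<le> 1}. ereal (V_tilde blk m f p x y))"

definition stationary_nash :: "('n::finite \<Rightarrow> nat) \<Rightarrow> nat \<Rightarrow> (nat \<Rightarrow> (real ^ 'n) set) \<Rightarrow>
    (real ^ 'n \<Rightarrow> real) \<Rightarrow> (real ^ 'n \<Rightarrow> real) \<Rightarrow> real ^ 'n \<Rightarrow> bool" where
  "stationary_nash blk m T f p x \<longleftrightarrow> x \<in> prod_set blk m T \<and> nash_gap blk m T f p x \<le> 0"

definition approx_stationary_nash :: "('n::finite \<Rightarrow> nat) \<Rightarrow> nat \<Rightarrow> (nat \<Rightarrow> (real ^ 'n) set) \<Rightarrow>
    (real ^ 'n \<Rightarrow> real) \<Rightarrow> (real ^ 'n \<Rightarrow> real) \<Rightarrow> real \<Rightarrow> real ^ 'n \<Rightarrow> bool" where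
  "approx_stationary_nash blk m T f p \<epsilon> x \<longleftrightarrow>
     x \<in> prod_set blk m T \<and> nash_gap blk m T f p x \<le> ereal \<epsilon>"

definition stationary :: "('n::finite \<Rightarrow> nat) \<Rightarrow> nat \<Rightarrow> (nat \<Rightarrow> (real ^ 'n) set) \<Rightarrow>
    (real ^ 'n \<Rightarrow> real) \<Rightarrow> (real ^ 'n \<Rightarrow> real) \<Rightarrow> real ^ 'n \<Rightarrow> bool" where
  "stationary blk m T f p x \<longleftrightarrow> x \<in> prod_set blk m T \<and>
     (SUP y \<in> {y \<in> prod_set blk m T. norm (y - x) \<le> 1}.
        ereal ((- grad UNIV f x) \<bullet> (y - x) + p x - p y)) \<le> 0"

text \<open>Nonemptiness is required because the distance \<^const>\<open>infdist\<close> to the empty set is 0.\<close>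

definition converges_to_set :: "(nat \<Rightarrow> 'a::metric_space) \<Rightarrow> 'a set \<Rightarrow> bool" where
  "converges_to_set X S \<longleftrightarrow> S \<noteq> {} \<and> (\<lambda>n. infdist (X n) S) \<longlonglongrightarrow> 0"


section \<open>The algorithm\<close>

text \<open>
  The restriction of h to the i-th block: blocks before the i-th are taken from u (the current
  iterate), blocks after the i-th from v (the previous iterate).
\<close>

definition block_slice :: "('n::finite \<Rightarrow> nat) \<Rightarrow> (real ^ 'n \<Rightarrow> real) \<Rightarrow> nat \<Rightarrow>
    real ^ 'n \<Rightarrow> real ^ 'n \<Rightarrow> real ^ 'n \<Rightarrow> real" where
  "block_slice blk h i u v x =
     h (\<chi> j. if blk j < i then u $ j else if blk j = i then x $ j else v $ j)"

definition majorizing_surrogate :: "(real ^ 'n::finite) set \<Rightarrow> (real ^ 'n) set \<Rightarrow>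
    (real ^ 'n \<Rightarrow> real) \<Rightarrow> real ^ 'n \<Rightarrow> (real ^ 'n \<Rightarrow> real) \<Rightarrow> bool" where
  "majorizing_surrogate S A h x0 g \<longleftrightarrow>
     (\<forall>x\<in>A. g differentiable (at x within S)) \<and>
     (\<forall>x\<in>A. h x \<le> g x) \<and> g x0 = h x0 \<and> grad S g x0 = grad S h x0"

definition trust_region :: "(real ^ 'n::finite) set \<Rightarrow> ereal \<Rightarrow> real ^ 'n \<Rightarrow> (real ^ 'n) set" where
  "trust_region A R x0 = {x \<in> A. ereal (norm (x - x0)) \<le> R}"

text \<open>
  \<open>\<theta> n\<close> is the n-th iterate and \<open>g n i\<close> the surrogate for block i in iteration n \<open>\<ge>\<close> 1; the values
  r 0 and g 0 are never used.
\<close>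

definition bmm_dr :: "('n::finite \<Rightarrow> nat) \<Rightarrow> nat \<Rightarrow> (nat \<Rightarrow> (real ^ 'n) set) \<Rightarrow>
    (real ^ 'n \<Rightarrow> real) \<Rightarrow> (nat \<Rightarrow> ereal) \<Rightarrow> real \<Rightarrow>
    (nat \<Rightarrow> nat \<Rightarrow> real ^ 'n \<Rightarrow> real) \<Rightarrow> (nat \<Rightarrow> real ^ 'n) \<Rightarrow> bool" where
  "bmm_dr blk m T f r \<rho> g \<theta> \<longleftrightarrow>
     (\<forall>n\<ge>1. 0 < r n) \<and> 0 \<le> \<rho> \<and> \<theta> 0 \<in> prod_set blk m T \<and>
     (\<forall>n\<ge>1. \<forall>i\<in>{1..m}.
        majorizing_surrogate (block_space blk i) (T i)
          (block_slice blk f i (\<theta> n) (\<theta> (n - 1))) (block blk i (\<theta> (n - 1))) (g n i) \<and>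
        strongly_convex_on (T i) \<rho> (g n i) \<and>
        block blk i (\<theta> n) \<in> trust_region (T i) (r n) (block blk i (\<theta> (n - 1))))"

definition block_objective :: "('n::finite \<Rightarrow> nat) \<Rightarrow> (real ^ 'n \<Rightarrow> real) \<Rightarrow>
    (nat \<Rightarrow> nat \<Rightarrow> real ^ 'n \<Rightarrow> real) \<Rightarrow> (nat \<Rightarrow> real ^ 'n) \<Rightarrow> nat \<Rightarrow> nat \<Rightarrow> real ^ 'n \<Rightarrow> real" where
  "block_objective blk p g \<theta> n i x = g n i x + block_slice blk p i (\<theta> n) (\<theta> (n - 1)) x"

definition exact_updates :: "('n::finite \<Rightarrow> nat) \<Rightarrow> nat \<Rightarrow> (nat \<Rightarrow> (real ^ 'n) set) \<Rightarrow>
    (real ^ 'n \<Rightarrow> real) \<Rightarrow> (nat \<Rightarrow> ereal) \<Rightarrow> (nat \<Rightarrow> nat \<Rightarrow> real ^ 'n \<Rightarrow> real) \<Rightarrow>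
    (nat \<Rightarrow> real ^ 'n) \<Rightarrow> (nat \<Rightarrow> nat \<Rightarrow> real ^ 'n) \<Rightarrow> bool" where
  "exact_updates blk m T p r g \<theta> \<theta>s \<longleftrightarrow>
     (\<forall>n\<ge>1. \<forall>i\<in>{1..m}.
        is_arg_min (block_objective blk p g \<theta> n i)
          (\<lambda>x. x \<in> trust_region (T i) (r n) (block blk i (\<theta> (n - 1)))) (\<theta>s n i))"

definition optimality_gap :: "('n::finite \<Rightarrow> nat) \<Rightarrow> nat \<Rightarrow> (real ^ 'n \<Rightarrow> real) \<Rightarrow>
    (nat \<Rightarrow> nat \<Rightarrow> real ^ 'n \<Rightarrow> real) \<Rightarrow> (nat \<Rightarrow> real ^ 'n) \<Rightarrow> (nat \<Rightarrow> nat \<Rightarrow> real ^ 'n) \<Rightarrow>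
    nat \<Rightarrow> real" where
  "optimality_gap blk m p g \<theta> \<theta>s n =
     (MAX i\<in>{1..m}. block_objective blk p g \<theta> n i (block blk i (\<theta> n)) -
                    block_objective blk p g \<theta> n i (\<theta>s n i))"


section \<open>Assumptions\<close>

definition A1 :: "('n::finite \<Rightarrow> nat) \<Rightarrow> nat \<Rightarrow> (nat \<Rightarrow> (real ^ 'n) set) \<Rightarrow> bool" where
  "A1 blk m T \<longleftrightarrow>
     (\<forall>i\<in>{1..m}. T i \<subseteq> block_space blk i \<and> T i \<noteq> {} \<and> closed (T i) \<and> convex (T i))"

text \<open>
  Regularity of f and p is only required at the points of the constraint set, so that f and p may
  as well be given on (a neighbourhood of) that set only.
\<close>

definition A2 :: "('n::finite \<Rightarrow> nat) \<Rightarrow> nat \<Rightarrow> (nat \<Rightarrow> (real ^ 'n) set) \<Rightarrow>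
    (real ^ 'n \<Rightarrow> real) \<Rightarrow> (real ^ 'n \<Rightarrow> real) \<Rightarrow> bool" where
  "A2 blk m T f p \<longleftrightarrow>
     (let \<Theta> = prod_set blk m T in
       (\<forall>x\<in>\<Theta>. f differentiable (at x)) \<and> continuous_on \<Theta> (grad UNIV f) \<and>
       convex_on \<Theta> p \<and> continuous_on \<Theta> p \<and>
       (\<forall>C. compact C \<and> C \<subseteq> \<Theta> \<longrightarrow>
          (\<exists>L. L-lipschitz_on C (grad UNIV f) \<and> L-lipschitz_on C p)) \<and>
       bdd_below ((\<lambda>x. f x + p x) ` \<Theta>) \<and>
       (\<forall>a. compact {x \<in> \<Theta>. f x + p x \<le> a}))"

definition A3 :: "('n::finite \<Rightarrow> nat) \<Rightarrow> nat \<Rightarrow> (nat \<Rightarrow> (real ^ 'n) set) \<Rightarrow>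
    (nat \<Rightarrow> ereal) \<Rightarrow> real \<Rightarrow> real \<Rightarrow> (nat \<Rightarrow> nat \<Rightarrow> real ^ 'n \<Rightarrow> real) \<Rightarrow> bool" where
  "A3 blk m T r Lg \<rho> g \<longleftrightarrow>
     0 < Lg \<and>
     (\<forall>n\<ge>1. \<forall>i\<in>{1..m}. Lg-lipschitz_on (T i) (grad (block_space blk i) (g n i))) \<and>
     0 \<le> \<rho> \<and> (\<forall>n\<ge>1. \<forall>i\<in>{1..m}. strongly_convex_on (T i) \<rho> (g n i)) \<and>
     ((\<Sum>n. (r (Suc n))\<^sup>2) < \<infinity> \<and>
        (\<lambda>n. real_of_ereal (r (Suc n)) / real_of_ereal (r n)) \<in> O(\<lambda>_. 1)
      \<or> (\<forall>n\<ge>1. r n = \<infinity>) \<and> 0 < \<rho>)"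

definition A4 :: "(nat \<Rightarrow> real) \<Rightarrow> bool" where
  "A4 \<Delta> \<longleftrightarrow> summable (\<lambda>n. \<Delta> (Suc n))"

text \<open>
  \<open>\<theta>\<close> is a (possibly inexact) output of the algorithm satisfying A3 and A4, with optimality
  gaps \<open>\<Delta> n\<close>, n \<open>\<ge>\<close> 1.
\<close>

definition bmm_dr_output :: "('n::finite \<Rightarrow> nat) \<Rightarrow> nat \<Rightarrow> (nat \<Rightarrow> (real ^ 'n) set) \<Rightarrow>
    (real ^ 'n \<Rightarrow> real) \<Rightarrow> (real ^ 'n \<Rightarrow> real) \<Rightarrow> (nat \<Rightarrow> ereal) \<Rightarrow> real \<Rightarrow> real \<Rightarrow>
    (nat \<Rightarrow> real ^ 'n) \<Rightarrow> (nat \<Rightarrow> real) \<Rightarrow> bool" where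
  "bmm_dr_output blk m T f p r Lg \<rho> \<theta> \<Delta> \<longleftrightarrow>
     (\<exists>g \<theta>s. bmm_dr blk m T f r \<rho> g \<theta> \<and> exact_updates blk m T p r g \<theta> \<theta>s \<and>
        (\<forall>n\<ge>1. \<Delta> n = optimality_gap blk m p g \<theta> \<theta>s n) \<and> A3 blk m T r Lg \<rho> g \<and> A4 \<Delta>)"


section \<open>Worst-case iteration complexity\<close>

definition first_hit :: "('n::finite \<Rightarrow> nat) \<Rightarrow> nat \<Rightarrow> (nat \<Rightarrow> (real ^ 'n) set) \<Rightarrow>
    (real ^ 'n \<Rightarrow> real) \<Rightarrow> (real ^ 'n \<Rightarrow> real) \<Rightarrow> (nat \<Rightarrow> real ^ 'n) \<Rightarrow> real \<Rightarrow> enat" where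
  "first_hit blk m T f p \<theta> \<epsilon> =
     (INF n \<in> {n. 1 \<le> n \<and> approx_stationary_nash blk m T f p \<epsilon> (\<theta> n)}. enat n)"

text \<open>
  The worst case is taken over all outputs initialized in K whose total optimality gap is at
  most D. For a noncompact constraint set, the number of iterations is in general not bounded
  over all initializations (think of steps of length at most 1 for the function
  \<open>x \<mapsto> sqrt (1 + x\<^sup>2)\<close> on the real line), hence the parameter K, which below is an arbitrary compact
  subset of the constraint set (the constraint set itself, if that is compact).
\<close>

definition iteration_complexity :: "('n::finite \<Rightarrow> nat) \<Rightarrow> nat \<Rightarrow> (nat \<Rightarrow> (real ^ 'n) set) \<Rightarrow>
    (real ^ 'n \<Rightarrow> real) \<Rightarrow> (real ^ 'n \<Rightarrow> real) \<Rightarrow> (nat \<Rightarrow> ereal) \<Rightarrow> real \<Rightarrow> real \<Rightarrow>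
    (real ^ 'n) set \<Rightarrow> real \<Rightarrow> real \<Rightarrow> enat" where
  "iteration_complexity blk m T f p r Lg \<rho> K D \<epsilon> =
     (SUP \<theta> \<in> {\<theta>. \<exists>\<Delta>. bmm_dr_output blk m T f p r Lg \<rho> \<theta> \<Delta> \<and> \<theta> 0 \<in> K \<and> (\<Sum>n. \<Delta> (Suc n)) \<le> D}.
        first_hit blk m T f p \<theta> \<epsilon>)"

end

theory Submission
  imports Defs
begin

text \<open>
  One iteration from v to u is tested against \<open>v + b * (y - v)\<close>, block by block: the surrogate is
  smooth and tangent to f, and p is convex along a block, so the decrease of F is at least b times
  the stationarity gap at v, up to the optimality gap and errors of order \<open>Lg * b\<^sup>2\<close> and
  \<open>b * norm (u - v)\<close>, the latter because the blocks are updated successively. The steps are square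
  summable, by the trust regions or, for \<open>\<rho> > 0\<close>, by the quadratic growth of the block objectives.
  Weights b chosen for the horizon n, proportional to the radii or constant, give the rates; the
  constant \<open>1 / sqrt (n * (1 + Lg + 1 / \<rho>))\<close>, respectively
  \<open>1 / sqrt (n * (1 + Lg))\<close> capped at the last radius, makes the complexity linear in Lg.
  For diminishing radii, the Lipschitz continuity of the gap upgrades the summability of
  radius times gap to convergence of the gap to 0.
\<close>

section \<open>Block coordinates\<close>

text \<open>The smoothness of f and p is only local, so everything rests on compactness. One
  iteration raises F by at most \<open>m * \<Delta> n\<close>, hence all iterates and all
  intermediate points of all runs that start in K with total gap at most D stay in one sublevel set.
  The constants come from a ball around that set and are fixed before the radii, \<open>Lg\<close>,
  \<open>\<rho>\<close> and the run; only this order of quantifiers makes the dependence on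
  \<open>Lg\<close> and \<open>\<rho>\<close> explicit.

  The error \<open>b * norm (u - v)\<close> is handled in two ways. With radii it is at most a
  constant times the squared radius, a summable term free of \<open>Lg\<close>, so that b can be
  adapted to \<open>Lg\<close> afterwards. Without radii it is split between
  \<open>b\<^sup>2 / \<rho>\<close> and the decrease of F.

  The gap at iterate k is controlled by iteration k + 1, that is, by radius k + 1. This index shift
  accounts for the quotient of the first two radii in the rate, and it lets the first radius be
  arbitrary in the complexity bound.\<close>

definition partial_upd ::
    "('n::finite \<Rightarrow> nat) \<Rightarrow> nat \<Rightarrow> real ^ 'n \<Rightarrow> real ^ 'n \<Rightarrow> real ^ 'n" where
  "partial_upd blk i u v = (\<chi> j. if blk j < i then u $ j else v $ j)"

lemma block_nth [simp]: "block blk i x $ j = (if blk j = i then x $ j else 0)"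
  by (simp add: block_def)

lemma block_upd_nth [simp]: "block_upd blk x i y $ j = (if blk j = i then y $ j else x $ j)"
  by (simp add: block_upd_def)

lemma partial_upd_nth [simp]: "partial_upd blk i u v $ j = (if blk j < i then u $ j else v $ j)"
  by (simp add: partial_upd_def)

lemma bounded_linear_block: "bounded_linear (block blk i)"
  by (intro linear_conv_bounded_linear[THEN iffD1] linearI) (auto simp: vec_eq_iff)

lemma block_diff: "block blk i (x - y) = block blk i x - block blk i y"
  by (simp add: vec_eq_iff)

lemma block_in_block_space [simp]: "block blk i x \<in> block_space blk i"
  by (simp add: block_space_def)

lemma block_of_block_space: "x \<in> block_space blk i \<Longrightarrow> block blk i x = x"
  by (auto simp: block_space_def vec_eq_iff)

lemma subspace_block_space: "subspace (block_space blk i)"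
  by (auto simp: subspace_def block_space_def)

lemma norm_block_le: "norm (block blk i x) \<le> norm x"
  by (rule norm_le_componentwise_cart) simp

lemma inner_block: "block blk i x \<bullet> y = x \<bullet> block blk i y"
  by (auto simp: inner_vec_def intro!: sum.cong)

lemma inner_block_block: "block blk i x \<bullet> block blk i y = x \<bullet> block blk i y"
  by (auto simp: inner_vec_def intro!: sum.cong)

lemma sum_block:
  assumes "range blk = {1..m}"
  shows "(\<Sum>i=1..m. block blk i x) = x"
proof -
  have "blk j \<in> {1..m}" for j using rangeI[of blk j] unfolding assms .
  then have "(\<Sum>i=1..m. if blk j = i then x $ j else 0) = x $ j" for j
    by (simp add: sum.delta')
  then show ?thesis by (simp add: vec_eq_iff)
qed

lemma norm_block_upd_diff_le:
  "norm (block_upd blk x i y - block_upd blk x' i y) \<le> norm (x - x')"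
  by (rule norm_le_componentwise_cart) simp

lemma block_upd_self [simp]: "block_upd blk x i x = x"
  by (simp add: vec_eq_iff)

lemma block_upd_block [simp]: "block_upd blk x i (block blk i y) = block_upd blk x i y"
  by (simp add: vec_eq_iff)

lemma norm_block_upd_le: "norm (block_upd blk x i y) \<le> norm x + norm y"
proof -
  have "block_upd blk x i y = (x - block blk i x) + block blk i y" by (simp add: vec_eq_iff)
  moreover have "norm (x - block blk i x) \<le> norm x" by (rule norm_le_componentwise_cart) simp
  ultimately show ?thesis
    using norm_triangle_ineq[of "x - block blk i x" "block blk i y"] norm_block_le[of blk i y]
    by simp
qed

lemma sum_norm_block_squared:
  assumes "range blk = {1..m}"
  shows "(\<Sum>i=1..m. (norm (block blk i x))\<^sup>2) = (norm x)\<^sup>2"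
proof -
  have "(\<Sum>i=1..m. (norm (block blk i x))\<^sup>2) = (\<Sum>i=1..m. block blk i x) \<bullet> x"
    by (simp add: power2_norm_eq_inner inner_sum_right inner_block_block inner_commute)
  then show ?thesis unfolding sum_block[OF assms] by (simp add: power2_norm_eq_inner)
qed

lemma block_upd_in_prod_set:
  assumes "x \<in> prod_set blk m T" "y \<in> T i" "T i \<subseteq> block_space blk i"
  shows "block_upd blk x i y \<in> prod_set blk m T"
proof -
  have "block blk k (block_upd blk x i y) = (if k = i then y else block blk k x)" for k
    using assms(2,3) by (auto simp: vec_eq_iff block_space_def)
  then show ?thesis using assms by (auto simp: prod_set_def)
qed

lemma partial_upd_in_prod_set:
  assumes "u \<in> prod_set blk m T" "v \<in> prod_set blk m T"
  shows "partial_upd blk i u v \<in> prod_set blk m T"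
proof -
  have "block blk k (partial_upd blk i u v) = (if k < i then block blk k u else block blk k v)" for k
    by (auto simp: vec_eq_iff)
  then show ?thesis using assms by (auto simp: prod_set_def)
qed

lemma norm_partial_upd_diff_le: "norm (partial_upd blk i u v - v) \<le> norm (u - v)"
  by (rule norm_le_componentwise_cart) simp

lemma block_partial_upd: "block blk i (partial_upd blk i u v) = block blk i v"
  by (simp add: vec_eq_iff)

lemma block_upd_partial_upd: "block_upd blk (partial_upd blk i u v) i u = partial_upd blk (Suc i) u v"
  by (auto simp: vec_eq_iff)

lemma block_upd_partial_upd_same: "block_upd blk (partial_upd blk i u v) i v = partial_upd blk i u v"
  by (simp add: vec_eq_iff)

lemma partial_upd_first:
  assumes "range blk = {1..m}"
  shows "partial_upd blk 1 u v = v"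
proof -
  have "\<not> blk j < 1" for j using rangeI[of blk j] unfolding assms by simp
  then show ?thesis unfolding vec_eq_iff partial_upd_nth by metis
qed

lemma partial_upd_last:
  assumes "range blk = {1..m}"
  shows "partial_upd blk (Suc m) u v = u"
proof -
  have "blk j < Suc m" for j using rangeI[of blk j] unfolding assms by simp
  then show ?thesis by (simp add: vec_eq_iff)
qed

lemma block_slice_eq: "block_slice blk h i u v x = h (block_upd blk (partial_upd blk i u v) i x)"
  unfolding block_slice_def by (rule arg_cong[where f = h]) (auto simp: vec_eq_iff)

lemma closed_prod_set:
  assumes "\<And>i. i \<in> {1..m} \<Longrightarrow> closed (T i)"
  shows "closed (prod_set blk m T)"
proof -
  have "prod_set blk m T = (\<Inter>i\<in>{1..m}. block blk i -` T i)"
    by (auto simp: prod_set_def)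
  moreover have "closed (block blk i -` T i)" if "i \<in> {1..m}" for i
    by (intro continuous_closed_vimage assms that)
      (simp add: bounded_linear_block linear_continuous_at)
  ultimately show ?thesis by auto
qed

section \<open>Gradients within a block\<close>

text \<open>Existence for the description operator in \<open>grad\<close>: the linear map D is
  represented by the vector \<open>adjoint D 1\<close>, and \<open>grad_eqI\<close> gives
  uniqueness.\<close>

lemma has_derivative_grad_UNIV:
  assumes "f differentiable (at x)"
  shows "(f has_derivative (\<lambda>d. grad UNIV f x \<bullet> d)) (at x)"
proof -
  obtain D where D: "(f has_derivative D) (at x)"
    using assms by (auto simp: differentiable_def)
  have lin: "linear D" using D by (rule has_derivative_linear)
  have "D = (\<lambda>d. adjoint D 1 \<bullet> d)"
    using adjoint_works[OF lin, of _ 1] by (auto simp: inner_commute)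
  with D show ?thesis using grad_eqI[of UNIV x "adjoint D 1" f] by simp
qed

text \<open>A derivative within a block space matters only on that space, so the vector representing
  it may be projected onto the block. The difference quotients within the space do not change, and
  the projected vector is the one that \<open>grad\<close> selects.\<close>

lemma has_derivative_grad_block_space:
  assumes "g differentiable (at x within block_space blk i)" and x: "x \<in> block_space blk i"
  shows "grad (block_space blk i) g x \<in> block_space blk i"
    and "(g has_derivative (\<lambda>d. grad (block_space blk i) g x \<bullet> d)) (at x within block_space blk i)"
proof -
  let ?S = "block_space blk i"
  obtain D where D: "(g has_derivative D) (at x within ?S)"
    using assms by (auto simp: differentiable_def)
  have lin: "linear D" using D by (rule has_derivative_linear)
  let ?v = "block blk i (adjoint D 1)"
  have DD: "D d = ?v \<bullet> d" if "d \<in> ?S" for d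
    using adjoint_works[OF lin, of d 1] block_of_block_space[OF that]
    by (metis inner_block inner_commute inner_real_def mult.right_neutral)
  have "(g has_derivative (\<lambda>d. ?v \<bullet> d)) (at x within ?S)"
    unfolding has_derivative_within
  proof
    show "bounded_linear (\<lambda>d. ?v \<bullet> d)" by (rule bounded_linear_inner_right)
    have "((\<lambda>y. (1 / norm (y - x)) *\<^sub>R (g y - (g x + D (y - x)))) \<longlongrightarrow> 0) (at x within ?S)"
      using D by (simp add: has_derivative_within)
    then show "((\<lambda>y. (1 / norm (y - x)) *\<^sub>R (g y - (g x + ?v \<bullet> (y - x)))) \<longlongrightarrow> 0) (at x within ?S)"
    proof (rule Lim_transform_eventually)
      show "\<forall>\<^sub>F y in at x within ?S. (1 / norm (y - x)) *\<^sub>R (g y - (g x + D (y - x))) =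
          (1 / norm (y - x)) *\<^sub>R (g y - (g x + ?v \<bullet> (y - x)))"
        using x DD subspace_diff[OF subspace_block_space, of _ blk i x]
        by (simp add: eventually_at_filter)
    qed
  qed
  moreover from this have "grad ?S g x = ?v"
    by (intro grad_eqI subspace_block_space x) simp_all
  ultimately show "grad ?S g x \<in> ?S"
    and "(g has_derivative (\<lambda>d. grad ?S g x \<bullet> d)) (at x within ?S)" by simp_all
qed

text \<open>Chain rule: the slice is f after an affine map with linear part
  \<open>block blk i\<close>. This turns the tangency condition on a surrogate into a statement
  about the full gradient of f.\<close>

lemma grad_block_slice:
  assumes "f differentiable (at w)"
  shows "grad (block_space blk i) (\<lambda>x. f (block_upd blk w i x)) (block blk i w) =
    block blk i (grad UNIV f w)"
proof (rule grad_eqI[OF subspace_block_space])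
  let ?v = "block blk i (grad UNIV f w)"
  have upd: "block_upd blk w i x = (w - block blk i w) + block blk i x" for x
    by (simp add: vec_eq_iff)
  have A: "(block_upd blk w i has_derivative block blk i) (at (block blk i w) within block_space blk i)"
    unfolding upd using bounded_linear.has_derivative[OF bounded_linear_block has_derivative_ident]
    by (auto intro!: derivative_eq_intros)
  have "(f has_derivative (\<lambda>d. grad UNIV f w \<bullet> d)) (at (block_upd blk w i (block blk i w)))"
    using has_derivative_grad_UNIV[OF assms] by simp
  from has_derivative_compose[OF A this]
  show "((\<lambda>x. f (block_upd blk w i x)) has_derivative (\<lambda>d. ?v \<bullet> d))
      (at (block blk i w) within block_space blk i)"
    by (simp add: inner_block)
qed simp_all

text \<open>Mean value theorem on the segment from x to y, then Lipschitz continuity of the gradient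
  at the single intermediate point. Not integrating the gradient costs the factor 1/2 in front of
  \<open>Lg\<close>, which only affects constants.\<close>

lemma descent_block_space:
  assumes T: "convex A" "A \<subseteq> block_space blk i"
    and diff: "\<And>x. x \<in> A \<Longrightarrow> g differentiable (at x within block_space blk i)"
    and lip: "Lg-lipschitz_on A (grad (block_space blk i) g)"
    and xy: "x \<in> A" "y \<in> A"
  shows "g y \<le> g x + grad (block_space blk i) g x \<bullet> (y - x) + Lg * (norm (y - x))\<^sup>2"
proof -
  let ?S = "block_space blk i" and ?d = "y - x"
  let ?grad = "grad (block_space blk i) g"
  have mem: "x + t *\<^sub>R ?d \<in> A" if "0 \<le> t" "t \<le> 1" for t
  proof -
    have "x + t *\<^sub>R ?d = (1 - t) *\<^sub>R x + t *\<^sub>R y" by (simp add: algebra_simps)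
    then show ?thesis using convexD_alt[OF T(1) xy] that by simp
  qed
  have S: "x \<in> ?S" "?d \<in> ?S" using xy T(2) subspace_diff[OF subspace_block_space] by blast+
  then have sub: "range (\<lambda>t::real. x + t *\<^sub>R ?d) \<subseteq> ?S"
    by (auto intro: subspace_add subspace_scale subspace_block_space)
  have D: "((\<lambda>t. g (x + t *\<^sub>R ?d)) has_derivative (\<lambda>h. h * (?grad (x + t *\<^sub>R ?d) \<bullet> ?d))) (at t)"
    if t: "0 \<le> t" "t \<le> 1" for t
  proof -
    have line: "((\<lambda>t::real. x + t *\<^sub>R ?d) has_derivative (\<lambda>t. t *\<^sub>R ?d)) (at t)"
      by (auto intro!: derivative_eq_intros)
    have "(g has_derivative (\<lambda>d. ?grad (x + t *\<^sub>R ?d) \<bullet> d)) (at (x + t *\<^sub>R ?d) within ?S)"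
      using has_derivative_grad_block_space(2) diff mem[OF t] T(2) by blast
    from has_derivative_in_compose[OF line has_derivative_subset[OF this sub]]
    show ?thesis by simp
  qed
  obtain t :: real where t: "0 < t" "t < 1" and
    eq: "g (x + 1 *\<^sub>R ?d) - g (x + 0 *\<^sub>R ?d) = (1 - 0) * (?grad (x + t *\<^sub>R ?d) \<bullet> ?d)"
    using mvt_simple[of 0 1 "\<lambda>t. g (x + t *\<^sub>R ?d)" "\<lambda>t h. h * (?grad (x + t *\<^sub>R ?d) \<bullet> ?d)",
      OF zero_less_one has_derivative_at_withinI[OF D]] by auto
  have "(?grad (x + t *\<^sub>R ?d) - ?grad x) \<bullet> ?d \<le> norm (?grad (x + t *\<^sub>R ?d) - ?grad x) * norm ?d"
    by (rule norm_cauchy_schwarz)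
  also have "\<dots> \<le> (Lg * norm (t *\<^sub>R ?d)) * norm ?d"
    using lipschitz_onD[OF lip mem[of t] xy(1)] t
    by (intro mult_right_mono) (simp_all add: dist_norm)
  also have "\<dots> = (Lg * (norm ?d)\<^sup>2) * t" using t by (simp add: power2_eq_square)
  also have "\<dots> \<le> Lg * (norm ?d)\<^sup>2"
    using t lipschitz_on_nonneg[OF lip] by (intro mult_left_le) auto
  finally show ?thesis using eq by (simp add: inner_diff_left)
qed

section \<open>One block update\<close>

lemma convex_slice:
  assumes p: "convex_on (prod_set blk m T) p" and w: "w \<in> prod_set blk m T"
    and T: "convex (T i)" "T i \<subseteq> block_space blk i"
  shows "convex_on (T i) (\<lambda>x. p (block_upd blk w i x))"
proof (rule convex_onI)
  fix t :: real and x y assume t: "0 < t" "t < 1" and xy: "x \<in> T i" "y \<in> T i"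
  have "block_upd blk w i ((1 - t) *\<^sub>R x + t *\<^sub>R y) =
      (1 - t) *\<^sub>R block_upd blk w i x + t *\<^sub>R block_upd blk w i y"
    by (simp add: vec_eq_iff algebra_simps)
  then show "p (block_upd blk w i ((1 - t) *\<^sub>R x + t *\<^sub>R y)) \<le>
      (1 - t) * p (block_upd blk w i x) + t * p (block_upd blk w i y)"
    using convex_onD[OF p, of t "block_upd blk w i x" "block_upd blk w i y"] t
      block_upd_in_prod_set[OF w] xy T(2) by simp
qed (rule T)

lemma strongly_convex_on_add:
  assumes "strongly_convex_on S \<rho> g" "convex_on S q"
  shows "strongly_convex_on S \<rho> (\<lambda>x. g x + q x)"
proof -
  have "convex_on S (\<lambda>x. (g x - \<rho> / 2 * (norm x)\<^sup>2) + q x)"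
    using assms unfolding strongly_convex_on_def by (intro convex_on_add)
  then show ?thesis by (simp add: strongly_convex_on_def algebra_simps)
qed

text \<open>Convexity of h minus its quadratic part at the midpoint; the parallelogram identity
  leaves the term \<open>\<rho> / 8\<close>.\<close>

lemma strongly_convex_on_midpoint:
  assumes "strongly_convex_on S \<rho> h" "x \<in> S" "y \<in> S"
  shows "h ((1 / 2) *\<^sub>R x + (1 / 2) *\<^sub>R y) + \<rho> / 8 * (norm (x - y))\<^sup>2 \<le> (h x + h y) / 2"
proof -
  let ?z = "(1 / 2) *\<^sub>R x + (1 / 2) *\<^sub>R y"
  have "h ?z - \<rho> / 2 * (norm ?z)\<^sup>2 \<le>
      (1 / 2) * (h x - \<rho> / 2 * (norm x)\<^sup>2) + (1 / 2) * (h y - \<rho> / 2 * (norm y)\<^sup>2)"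
    using convex_onD[of S "\<lambda>x. h x - \<rho> / 2 * (norm x)\<^sup>2" "1/2" x y] assms
    unfolding strongly_convex_on_def by simp
  moreover have "(norm ?z)\<^sup>2 = (norm x)\<^sup>2 / 2 + (norm y)\<^sup>2 / 2 - (norm (x - y))\<^sup>2 / 4"
    by (simp add: power2_norm_eq_inner inner_add inner_diff inner_commute field_simps)
  ultimately show ?thesis by (simp add: algebra_simps)
qed

text \<open>Comparing the minimizer with the midpoint between it and y involves no derivative of h,
  as is necessary for a block objective that contains the nonsmooth p. The price is the constant
  \<open>\<rho> / 4\<close> in place of \<open>\<rho> / 2\<close>.\<close>

lemma strongly_convex_on_quadratic_growth:
  assumes "strongly_convex_on S \<rho> h" "convex A" "A \<subseteq> S"
    and x: "is_arg_min h (\<lambda>x. x \<in> A) x" and y: "y \<in> A"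
  shows "\<rho> / 4 * (norm (y - x))\<^sup>2 \<le> h y - h x"
proof -
  have xA: "x \<in> A" using x by (simp add: is_arg_min_def)
  let ?z = "(1 / 2) *\<^sub>R y + (1 / 2) *\<^sub>R x"
  have "?z \<in> A"
    using convexD[OF assms(2) y xA, of "1/2" "1/2"] by simp
  then have "h x \<le> h ?z"
    using x by (auto simp: is_arg_min_def not_less)
  moreover have "h ?z + \<rho> / 8 * (norm (y - x))\<^sup>2 \<le> (h y + h x) / 2"
    using xA y assms(3) by (intro strongly_convex_on_midpoint[OF assms(1)]) auto
  ultimately show ?thesis by (simp add: field_simps)
qed

lemma convex_trust_region:
  assumes "convex A"
  shows "convex (trust_region A R x0)"
proof (cases R)
  case (real s)
  then have "trust_region A R x0 = A \<inter> cball x0 s"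
    by (auto simp: trust_region_def dist_norm norm_minus_commute)
  then show ?thesis using assms by (simp add: convex_Int)
next
  case PInf
  then show ?thesis using assms by (simp add: trust_region_def)
next
  case MInf
  then show ?thesis by (simp add: trust_region_def)
qed

text \<open>The point x is block i of \<open>(1 - b) * w + b * y\<close>. Smoothness bounds the
  surrogate there, tangency replaces its value and gradient by those of f, and convexity of p on the
  slice makes the change of p linear in b. The factor of b is the negative of the contribution of
  block i to \<open>V_tilde\<close>, so the bound is a first-order decrease plus a quadratic
  error.\<close>

lemma majorizer_test_point:
  fixes f p :: "real ^ 'n::finite \<Rightarrow> real"
  assumes p: "convex_on (prod_set blk m T) p"
    and T: "i \<in> {1..m}" "convex (T i)" "T i \<subseteq> block_space blk i"
    and w: "w \<in> prod_set blk m T" and f: "f differentiable (at w)"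
    and g: "majorizing_surrogate (block_space blk i) (T i)
        (\<lambda>x. f (block_upd blk w i x)) (block blk i w) g"
    and lip: "Lg-lipschitz_on (T i) (grad (block_space blk i) g)"
    and y: "y \<in> prod_set blk m T" and b: "0 \<le> b" "b \<le> 1"
  defines "x \<equiv> block blk i w + b *\<^sub>R block blk i (y - w)"
  shows "x \<in> T i"
    and "g x + p (block_upd blk w i x) \<le> f w + p w +
      b * (grad UNIV f w \<bullet> block blk i (y - w) + (p (block_upd blk w i y) - p w)) +
      Lg * b\<^sup>2 * (norm (y - w))\<^sup>2"
proof -
  let ?x0 = "block blk i w" and ?y = "block blk i y"
  have mem: "?x0 \<in> T i" "?y \<in> T i" using w y T(1) by (auto simp: prod_set_def)
  have x: "x = (1 - b) *\<^sub>R ?x0 + b *\<^sub>R ?y"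
    by (simp add: x_def vec_eq_iff algebra_simps)
  show xT: "x \<in> T i" using convexD_alt[OF T(2) mem b] x by simp
  have "g x \<le> g ?x0 + grad (block_space blk i) g ?x0 \<bullet> (x - ?x0) + Lg * (norm (x - ?x0))\<^sup>2"
    using g by (intro descent_block_space[OF T(2,3) _ lip mem(1) xT])
      (auto simp: majorizing_surrogate_def)
  moreover have "g ?x0 = f w" "grad (block_space blk i) g ?x0 = block blk i (grad UNIV f w)"
    using g grad_block_slice[OF f] by (simp_all add: majorizing_surrogate_def)
  moreover have "Lg * (norm (x - ?x0))\<^sup>2 \<le> Lg * (b\<^sup>2 * (norm (y - w))\<^sup>2)"
    using b lipschitz_on_nonneg[OF lip] norm_block_le[of blk i "y - w"]
    by (intro mult_left_mono) (auto simp: x_def power_mult_distrib intro!: mult_left_mono power_mono)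
  ultimately have "g x \<le> f w + b * (grad UNIV f w \<bullet> block blk i (y - w)) + Lg * b\<^sup>2 * (norm (y - w))\<^sup>2"
    by (simp add: x_def inner_block_block)
  moreover have "p (block_upd blk w i x) \<le> (1 - b) * p w + b * p (block_upd blk w i y)"
    using convex_onD[OF convex_slice[OF p w T(2,3)] b mem] x by simp
  ultimately show "g x + p (block_upd blk w i x) \<le> f w + p w +
      b * (grad UNIV f w \<bullet> block blk i (y - w) + (p (block_upd blk w i y) - p w)) +
      Lg * b\<^sup>2 * (norm (y - w))\<^sup>2"
    by (simp add: algebra_simps)
qed

section \<open>Properties of a run of the algorithm\<close>

locale block_problem =
  fixes blk :: "'n::finite \<Rightarrow> nat" and m :: nat
    and T :: "nat \<Rightarrow> (real ^ 'n) set" and f p :: "real ^ 'n \<Rightarrow> real"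
  assumes range_blk: "range blk = {1..m}"
    and A1: "A1 blk m T"
    and A2: "A2 blk m T f p"
begin

abbreviation "\<Theta> \<equiv> prod_set blk m T"
abbreviation "F x \<equiv> f x + p x"

lemma block_set:
  assumes "i \<in> {1..m}"
  shows "T i \<subseteq> block_space blk i" "closed (T i)" "convex (T i)"
  using A1 assms by (auto simp: A1_def)

lemma differentiable_f: "x \<in> \<Theta> \<Longrightarrow> f differentiable (at x)"
  using A2 by (simp add: A2_def Let_def)

lemma convex_p: "convex_on \<Theta> p"
  using A2 by (simp add: A2_def Let_def)

lemma m_ge_1: "1 \<in> {1..m}"
  using range_blk by (metis UNIV_not_empty atLeastatMost_empty_iff2 atLeastAtMost_iff image_is_empty le_refl)

end

locale bmm_run = block_problem blk m T f p
  for blk :: "'n::finite \<Rightarrow> nat" and m T f p +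
  fixes r :: "nat \<Rightarrow> ereal" and Lg \<rho> :: real
    and g :: "nat \<Rightarrow> nat \<Rightarrow> real ^ 'n \<Rightarrow> real" and \<theta> :: "nat \<Rightarrow> real ^ 'n"
    and \<theta>s :: "nat \<Rightarrow> nat \<Rightarrow> real ^ 'n" and \<Delta> :: "nat \<Rightarrow> real"
  assumes bmm: "bmm_dr blk m T f r \<rho> g \<theta>"
    and exact: "exact_updates blk m T p r g \<theta> \<theta>s"
    and gap: "\<And>n. n \<ge> 1 \<Longrightarrow> \<Delta> n = optimality_gap blk m p g \<theta> \<theta>s n"
    and A3: "A3 blk m T r Lg \<rho> g"
    and A4: "A4 \<Delta>"
begin

text \<open>The point at which the subproblem of block i in iteration n is posed: earlier blocks are
  new, block i and the later ones are old. It runs from the previous iterate at i = 1 to the new one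
  at i = m + 1.\<close>

definition mid :: "nat \<Rightarrow> nat \<Rightarrow> real ^ 'n" where
  "mid n i = partial_upd blk i (\<theta> n) (\<theta> (n - 1))"

abbreviation obj :: "nat \<Rightarrow> nat \<Rightarrow> real ^ 'n \<Rightarrow> real" where
  "obj n i \<equiv> block_objective blk p g \<theta> n i"

abbreviation tr :: "nat \<Rightarrow> nat \<Rightarrow> (real ^ 'n) set" where
  "tr n i \<equiv> trust_region (T i) (r n) (block blk i (\<theta> (n - 1)))"

lemma r_pos: "n \<ge> 1 \<Longrightarrow> 0 < r n"
  using bmm by (simp add: bmm_dr_def)

lemma rho_nonneg: "0 \<le> \<rho>"
  using bmm by (simp add: bmm_dr_def)

lemma Lg_pos: "0 < Lg"
  using A3 by (simp add: A3_def)

lemma update: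
  assumes "n \<ge> 1" "i \<in> {1..m}"
  shows "majorizing_surrogate (block_space blk i) (T i)
      (\<lambda>x. f (block_upd blk (mid n i) i x)) (block blk i (\<theta> (n - 1))) (g n i)"
    and "strongly_convex_on (T i) \<rho> (g n i)"
    and "block blk i (\<theta> n) \<in> tr n i"
    and "is_arg_min (obj n i) (\<lambda>x. x \<in> tr n i) (\<theta>s n i)"
    and "Lg-lipschitz_on (T i) (grad (block_space blk i) (g n i))"
  using bmm exact A3 assms
  by (auto simp: bmm_dr_def exact_updates_def A3_def mid_def block_slice_eq[abs_def])

lemma iterate_in: "\<theta> n \<in> \<Theta>"
proof (cases "n = 0")
  case False
  then have "block blk i (\<theta> n) \<in> T i" if "i \<in> {1..m}" for i
    using update(3)[of n i] that by (auto simp: trust_region_def)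
  then show ?thesis by (simp add: prod_set_def)
qed (use bmm in \<open>simp add: bmm_dr_def\<close>)

lemma mid_in: "mid n i \<in> \<Theta>"
  unfolding mid_def by (intro partial_upd_in_prod_set iterate_in)

lemma mid_first: "mid n 1 = \<theta> (n - 1)"
  unfolding mid_def by (rule partial_upd_first[OF range_blk])

lemma mid_last: "mid n (Suc m) = \<theta> n"
  unfolding mid_def by (rule partial_upd_last[OF range_blk])

lemma obj_eq: "obj n i x = g n i x + p (block_upd blk (mid n i) i x)"
  by (simp add: block_objective_def block_slice_eq mid_def)

section \<open>Objective values within one iteration and along a run\<close>

lemma gap_ge:
  assumes "n \<ge> 1" "i \<in> {1..m}"
  shows "obj n i (block blk i (\<theta> n)) - obj n i (\<theta>s n i) \<le> \<Delta> n"
  unfolding gap[OF assms(1)] optimality_gap_def using assms(2) by (intro Max_ge) auto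

lemma obj_min:
  assumes "n \<ge> 1" "i \<in> {1..m}" "x \<in> tr n i"
  shows "obj n i (\<theta>s n i) \<le> obj n i x"
  using update(4)[OF assms(1,2)] assms(3) by (auto simp: is_arg_min_def not_less)

lemma gap_nonneg: "n \<ge> 1 \<Longrightarrow> 0 \<le> \<Delta> n"
  using gap_ge[OF _ m_ge_1] obj_min[OF _ m_ge_1 update(3)[OF _ m_ge_1]] by fastforce

lemma obj_update:
  assumes "n \<ge> 1" "i \<in> {1..m}"
  shows "F (mid n (Suc i)) \<le> obj n i (block blk i (\<theta> n))"
proof -
  have "block blk i (\<theta> n) \<in> T i" using iterate_in[of n] assms(2) by (simp add: prod_set_def)
  with update(1)[OF assms]
  have "f (block_upd blk (mid n i) i (block blk i (\<theta> n))) \<le> g n i (block blk i (\<theta> n))"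
    unfolding majorizing_surrogate_def by blast
  then show ?thesis by (simp add: obj_eq mid_def block_upd_partial_upd)
qed

lemma obj_start:
  assumes "n \<ge> 1" "i \<in> {1..m}"
  shows "obj n i (block blk i (\<theta> (n - 1))) = F (mid n i)"
  using update(1)[OF assms]
  by (simp add: obj_eq majorizing_surrogate_def mid_def block_upd_partial_upd_same)

lemma start_in_tr: "n \<ge> 1 \<Longrightarrow> i \<in> {1..m} \<Longrightarrow> block blk i (\<theta> (n - 1)) \<in> tr n i"
  using iterate_in[of "n - 1"] r_pos[of n]
  by (auto simp: trust_region_def prod_set_def zero_ereal_def[symmetric])

text \<open>Majorization after the update, the optimality gap, and minimality of
  \<open>\<theta>s n i\<close>, in this order. Every point of the trust region thus becomes a
  competitor; the old block yields monotonicity up to the gap, the test point the first-order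
  decrease.\<close>

lemma F_mid_le_obj:
  assumes "n \<ge> 1" "i \<in> {1..m}" "x \<in> tr n i"
  shows "F (mid n (Suc i)) \<le> obj n i x + \<Delta> n"
  using obj_update[OF assms(1,2)] gap_ge[OF assms(1,2)] obj_min[OF assms] by linarith

lemma F_mid_Suc:
  assumes "n \<ge> 1" "i \<in> {1..m}"
  shows "F (mid n (Suc i)) \<le> F (mid n i) + \<Delta> n"
  using F_mid_le_obj[OF assms start_in_tr[OF assms]] obj_start[OF assms] by simp

lemma F_mid:
  assumes n: "n \<ge> 1" and "i \<le> m"
  shows "F (mid n (Suc i)) \<le> F (\<theta> (n - 1)) + m * \<Delta> n"
proof -
  have "F (mid n (Suc i)) \<le> F (\<theta> (n - 1)) + i * \<Delta> n"
    using \<open>i \<le> m\<close>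
  proof (induction i)
    case 0
    then show ?case using mid_first[of n] by simp
  next
    case (Suc i)
    then show ?case using F_mid_Suc[OF n, of "Suc i"] by (simp add: algebra_simps)
  qed
  moreover have "i * \<Delta> n \<le> m * \<Delta> n" using assms gap_nonneg by (intro mult_right_mono) auto
  ultimately show ?thesis by linarith
qed

lemma F_iterate_Suc: "F (\<theta> (Suc n)) \<le> F (\<theta> n) + m * \<Delta> (Suc n)"
  using F_mid[of "Suc n" m] mid_last[of "Suc n"] by simp

lemma F_iterate: "F (\<theta> n) \<le> F (\<theta> 0) + m * (\<Sum>k<n. \<Delta> (Suc k))"
proof (induction n)
  case (Suc n)
  then show ?case using F_iterate_Suc[of n] by (simp add: algebra_simps)
qed simp

lemma sum_gap_le: "(\<Sum>k<n. \<Delta> (Suc k)) \<le> (\<Sum>k. \<Delta> (Suc k))"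
  using A4 gap_nonneg by (intro sum_le_suminf) (auto simp: A4_def)

text \<open>The right-hand side depends on the run only through the initial value and the total gap.
  Hence one compact sublevel set contains the intermediate points of all runs under
  consideration.\<close>

lemma F_mid_bound:
  assumes "n \<ge> 1" "i \<le> m"
  shows "F (mid n (Suc i)) \<le> F (\<theta> 0) + m * (\<Sum>k. \<Delta> (Suc k))"
proof -
  obtain k where k: "n = Suc k" using assms(1) by (cases n) auto
  have "F (mid n (Suc i)) \<le> F (\<theta> 0) + m * (\<Sum>k<n. \<Delta> (Suc k))"
    using F_mid[OF assms] F_iterate[of k] by (simp add: k algebra_simps)
  also have "\<dots> \<le> F (\<theta> 0) + m * (\<Sum>k. \<Delta> (Suc k))"
    using sum_gap_le[of n] by (intro add_left_mono mult_left_mono) auto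
  finally show ?thesis .
qed

lemma sum_mid: "(\<Sum>i=1..m. F (mid n i) - F (mid n (Suc i))) = F (\<theta> (n - 1)) - F (\<theta> n)"
  using sum_Suc_diff[of 1 m "\<lambda>i. F (mid n i)"] m_ge_1
  by (simp add: mid_first[simplified] mid_last sum_subtractf)

section \<open>Lengths of the steps\<close>

lemma step_block:
  assumes n: "n \<ge> 1" and i: "i \<in> {1..m}"
  shows "\<rho> * (norm (block blk i (\<theta> n - \<theta> (n - 1))))\<^sup>2 \<le>
    8 * (F (mid n i) - F (mid n (Suc i)) + 2 * \<Delta> n)"
proof -
  let ?u = "block blk i (\<theta> n)" and ?v = "block blk i (\<theta> (n - 1))" and ?s = "\<theta>s n i"
  have "strongly_convex_on (T i) \<rho> (obj n i)"
    unfolding obj_eq[abs_def] using block_set[OF i]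
    by (intro strongly_convex_on_add update(2) n i convex_slice[OF convex_p mid_in]) auto
  from strongly_convex_on_quadratic_growth[OF this convex_trust_region _ update(4)[OF n i]]
  have growth: "\<rho> / 4 * (norm (y - ?s))\<^sup>2 \<le> obj n i y - obj n i ?s" if "y \<in> tr n i" for y
    using that block_set(3)[OF i] by (auto simp: trust_region_def)
  \<comment> \<open>The new block is only an approximate minimizer, so growth is applied around the
    exact one, to the new and to the old block, and the triangle inequality combines the
    two.\<close>
  have "norm (?u - ?v) \<le> norm (?u - ?s) + norm (?v - ?s)"
    using norm_triangle_ineq4[of "?u - ?s" "?v - ?s"] by simp
  then have "(norm (?u - ?v))\<^sup>2 \<le> (norm (?u - ?s) + norm (?v - ?s))\<^sup>2"
    by (intro power_mono) auto
  also have "\<dots> \<le> 2 * (norm (?u - ?s))\<^sup>2 + 2 * (norm (?v - ?s))\<^sup>2"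
    using sum_squares_bound[of "norm (?u - ?s)" "norm (?v - ?s)"] by (simp add: power2_sum)
  finally have "\<rho> * (norm (?u - ?v))\<^sup>2 \<le> \<rho> * (2 * (norm (?u - ?s))\<^sup>2 + 2 * (norm (?v - ?s))\<^sup>2)"
    using rho_nonneg by (rule mult_left_mono)
  also have "\<dots> = 8 * (\<rho> / 4 * (norm (?u - ?s))\<^sup>2 + \<rho> / 4 * (norm (?v - ?s))\<^sup>2)"
    by (simp add: algebra_simps)
  also have "\<dots> \<le> 8 * ((obj n i ?u - obj n i ?s) + (obj n i ?v - obj n i ?s))"
    using growth[OF update(3)[OF n i]] growth[OF start_in_tr[OF n i]] by simp
  also have "\<dots> \<le> 8 * (F (mid n i) - F (mid n (Suc i)) + 2 * \<Delta> n)"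
    using gap_ge[OF n i] obj_start[OF n i] obj_update[OF n i] by simp
  finally show ?thesis by (simp add: block_diff)
qed

text \<open>Blocks are orthogonal, so the squared lengths add up, and the values of F at the
  intermediate points telescope.\<close>

lemma step_strongly_convex:
  assumes n: "n \<ge> 1"
  shows "\<rho> * (norm (\<theta> n - \<theta> (n - 1)))\<^sup>2 \<le> 8 * (F (\<theta> (n - 1)) - F (\<theta> n) + 2 * m * \<Delta> n)"
proof -
  have "\<rho> * (norm (\<theta> n - \<theta> (n - 1)))\<^sup>2 = (\<Sum>i=1..m. \<rho> * (norm (block blk i (\<theta> n - \<theta> (n - 1))))\<^sup>2)"
    by (simp add: sum_norm_block_squared[OF range_blk, simplified] sum_distrib_left[symmetric])
  also have "\<dots> \<le> (\<Sum>i=1..m. 8 * (F (mid n i) - F (mid n (Suc i)) + 2 * \<Delta> n))"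
    by (intro sum_mono step_block n)
  also have "\<dots> = 8 * ((\<Sum>i=1..m. F (mid n i) - F (mid n (Suc i))) + 2 * m * \<Delta> n)"
    by (simp only: sum_distrib_left[symmetric] sum.distrib sum_constant card_atLeastAtMost) simp
  finally show ?thesis unfolding sum_mid by simp
qed

lemma step_radius:
  fixes s :: real
  assumes n: "n \<ge> 1" and s: "r n = ereal s"
  shows "norm (\<theta> n - \<theta> (n - 1)) \<le> m * s"
proof -
  have "norm (\<theta> n - \<theta> (n - 1)) \<le> (\<Sum>i=1..m. norm (block blk i (\<theta> n - \<theta> (n - 1))))"
    using norm_sum[of "\<lambda>i. block blk i (\<theta> n - \<theta> (n - 1))" "{1..m}"]
    by (simp add: sum_block[OF range_blk, simplified])
  also have "\<dots> \<le> (\<Sum>i=1..m. s)"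
    using update(3)[OF n] s by (intro sum_mono) (simp add: trust_region_def block_diff)
  finally show ?thesis by simp
qed

text \<open>In each block, the convex combination of v and y competes with the update. The
  subproblem is posed at \<open>mid n i\<close>, while \<open>V_tilde\<close> is evaluated at v.
  With d the length of the step, Lipschitz continuity moves the gradient at cost
  \<open>L * d * P\<close> and the two values of p at cost \<open>2 * L * d\<close>; this is the
  factor \<open>P + 2\<close>. The set B collects the points at which Lipschitz continuity is
  applied, and P bounds the distance to y, so that the test step has length at most
  \<open>b * P\<close> and fits the trust region.\<close>

lemma test_point:
  fixes n :: nat and y :: "real ^ 'n"
  defines "v \<equiv> \<theta> (n - 1)"
  assumes n: "n \<ge> 1" and y: "y \<in> \<Theta>" and b: "0 \<le> b" "b \<le> 1" "ereal (b * P) \<le> r n"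
    and lip: "L-lipschitz_on B (grad UNIV f)" "L-lipschitz_on B p"
    and B: "v \<in> B" "\<And>i. i \<in> {1..m} \<Longrightarrow> mid n i \<in> B \<and> block_upd blk (mid n i) i y \<in> B \<and>
        block_upd blk v i y \<in> B \<and> norm (y - mid n i) \<le> P"
  shows "b * V_tilde blk m f p v y \<le> F v - F (\<theta> n) + m * \<Delta> n + m * (Lg * b\<^sup>2 * P\<^sup>2) +
    b * (m * (L * (P + 2) * norm (\<theta> n - v)))"
proof -
  let ?d = "norm (\<theta> n - v)"
  let ?V = "\<lambda>i. grad UNIV f v \<bullet> block blk i (y - v) + (p (block_upd blk v i y) - p v)"
  have "mid n 1 = v" using mid_first v_def by simp
  with B(2)[OF m_ge_1] have P: "norm (y - v) \<le> P" by simp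
  then have P0: "0 \<le> P" using norm_ge_zero order_trans by blast
  have L0: "0 \<le> L" using lip(1) by (rule lipschitz_on_nonneg)
  have step: "F (mid n (Suc i)) - F (mid n i) \<le>
      \<Delta> n + b * ?V i + b * (L * (P + 2) * ?d) + Lg * b\<^sup>2 * P\<^sup>2" if i: "i \<in> {1..m}" for i
  proof -
    let ?w = "mid n i"
    let ?x = "block blk i ?w + b *\<^sub>R block blk i (y - ?w)"
    have w: "?w \<in> B" "block_upd blk ?w i y \<in> B" "block_upd blk v i y \<in> B" "norm (y - ?w) \<le> P"
      using B(2)[OF i] by auto
    \<comment> \<open>When its turn comes, block i still has its old value; so the test direction in
      block i is the same from the intermediate point as from v.\<close>
    have bw: "block blk i ?w = block blk i v" by (simp add: mid_def v_def block_partial_upd)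
    then have byw: "block blk i (y - ?w) = block blk i (y - v)" by (simp add: block_diff)
    have dw: "norm (?w - v) \<le> ?d" unfolding mid_def v_def by (rule norm_partial_upd_diff_le)
    have g: "majorizing_surrogate (block_space blk i) (T i)
        (\<lambda>x. f (block_upd blk ?w i x)) (block blk i ?w) (g n i)"
      using update(1)[OF n i] bw by (simp add: v_def)
    note test = majorizer_test_point[OF convex_p i block_set(3,1)[OF i] mid_in
        differentiable_f[OF mid_in] g update(5)[OF n i] y b(1,2)]
    have "norm (?x - block blk i v) \<le> b * P"
      using norm_block_le[of blk i "y - v"] P b(1) by (simp add: bw byw mult_left_mono)
    then have "ereal (norm (?x - block blk i v)) \<le> r n"
      using b(3) order_trans ereal_less_eq(3) by metis
    with test(1) have "?x \<in> tr n i" by (simp add: trust_region_def v_def)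
    from F_mid_le_obj[OF n i this] test(2)
    have 1: "F (mid n (Suc i)) \<le> F ?w +
        b * (grad UNIV f ?w \<bullet> block blk i (y - ?w) + (p (block_upd blk ?w i y) - p ?w)) +
        Lg * b\<^sup>2 * (norm (y - ?w))\<^sup>2 + \<Delta> n" by (simp add: obj_eq)
    have 2: "Lg * b\<^sup>2 * (norm (y - ?w))\<^sup>2 \<le> Lg * b\<^sup>2 * P\<^sup>2"
      using w(4) Lg_pos by (intro mult_left_mono power_mono) auto
    have "(grad UNIV f ?w - grad UNIV f v) \<bullet> block blk i (y - v) \<le>
        norm (grad UNIV f ?w - grad UNIV f v) * norm (block blk i (y - v))"
      by (rule norm_cauchy_schwarz)
    also have "\<dots> \<le> (L * ?d) * P"
    proof (intro mult_mono)
      show "norm (grad UNIV f ?w - grad UNIV f v) \<le> L * ?d"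
        using lipschitz_onD[OF lip(1) w(1) B(1)] mult_left_mono[OF dw L0] by (simp add: dist_norm)
      show "norm (block blk i (y - v)) \<le> P" using norm_block_le P order_trans by blast
    qed (use L0 in auto)
    finally have 3: "grad UNIV f ?w \<bullet> block blk i (y - v) \<le> grad UNIV f v \<bullet> block blk i (y - v) + L * ?d * P"
      by (simp add: inner_diff_left)
    have 4: "p (block_upd blk ?w i y) \<le> p (block_upd blk v i y) + L * ?d"
      using lipschitz_onD[OF lip(2) w(2,3)] norm_block_upd_diff_le[of blk ?w i y v] dw
        mult_left_mono[OF order_trans[OF norm_block_upd_diff_le[of blk ?w i y v] dw] L0]
      by (simp add: dist_norm)
    have 5: "p v \<le> p ?w + L * ?d"
      using lipschitz_onD[OF lip(2) w(1) B(1)] mult_left_mono[OF dw L0] by (simp add: dist_norm)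
    have "b * (grad UNIV f ?w \<bullet> block blk i (y - ?w) + (p (block_upd blk ?w i y) - p ?w)) \<le>
        b * (?V i + L * (P + 2) * ?d)"
      using 3 4 5 b(1) by (intro mult_left_mono) (simp_all add: byw algebra_simps)
    with 1 2 show ?thesis by (simp add: algebra_simps)
  qed
  have "F (\<theta> n) - F v = (\<Sum>i=1..m. F (mid n (Suc i)) - F (mid n i))"
    using sum_mid[of n] by (simp add: v_def sum_subtractf)
  also have "\<dots> \<le> (\<Sum>i=1..m. \<Delta> n + b * ?V i + b * (L * (P + 2) * ?d) + Lg * b\<^sup>2 * P\<^sup>2)"
    by (intro sum_mono step)
  also have "\<dots> = m * \<Delta> n + b * (\<Sum>i=1..m. ?V i) + m * (b * (L * (P + 2) * ?d)) + m * (Lg * b\<^sup>2 * P\<^sup>2)"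
    by (simp only: sum.distrib sum_distrib_left[symmetric] sum_constant card_atLeastAtMost) simp
  also have "(\<Sum>i=1..m. ?V i) = - V_tilde blk m f p v y"
  proof -
    have "(\<Sum>i=1..m. grad UNIV f v \<bullet> block blk i (y - v)) = grad UNIV f v \<bullet> (y - v)"
      by (simp add: inner_sum_right[symmetric] sum_block[OF range_blk, simplified])
    then show ?thesis by (simp add: V_tilde_def sum.distrib sum_subtractf)
  qed
  finally show ?thesis by (simp add: algebra_simps)
qed

end

section \<open>Reduction to real sequences\<close>

text \<open>
  What the analysis needs to know of a run: h bounds the stationarity gaps, e the decrease of the
  objective, d the lengths of the steps.
\<close>

definition descent_data ::
    "real \<Rightarrow> (nat \<Rightarrow> ereal) \<Rightarrow> real \<Rightarrow> real \<Rightarrow> (nat \<Rightarrow> real) \<Rightarrow> (nat \<Rightarrow> real) \<Rightarrow> (nat \<Rightarrow> real) \<Rightarrow> bool" where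
  "descent_data A r Lg \<rho> h e d \<longleftrightarrow>
     (\<forall>n. 0 \<le> h n \<and> 0 \<le> e n \<and> 0 \<le> d n) \<and> (\<forall>N. (\<Sum>k<N. e k) \<le> A) \<and>
     (\<forall>n b. 0 \<le> b \<and> b \<le> 1 \<and> ereal b \<le> r (Suc n) \<longrightarrow>
        b * h n \<le> A * e n + A * Lg * b\<^sup>2 + A * b * d n) \<and>
     (\<forall>n s. r (Suc n) = ereal s \<longrightarrow> d n \<le> A * s) \<and>
     (\<forall>n. \<rho> * (d n)\<^sup>2 \<le> A * e n)"

context block_problem
begin

lemma closed_Theta: "closed \<Theta>"
  by (intro closed_prod_set block_set)

lemma compact_lipschitz:
  assumes "compact B" "B \<subseteq> \<Theta>"
  obtains L where "L-lipschitz_on B (grad UNIV f)" "L-lipschitz_on B p"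
  using A2 assms unfolding A2_def Let_def by blast

lemma continuous_F: "continuous_on \<Theta> (\<lambda>x. F x)"
proof (intro continuous_on_add)
  show "continuous_on \<Theta> f"
    using differentiable_f differentiable_imp_continuous_within
    by (intro continuous_at_imp_continuous_on) blast
  show "continuous_on \<Theta> p" using A2 by (simp add: A2_def Let_def)
qed

lemma compact_sublevel: "compact {x \<in> \<Theta>. F x \<le> c}"
  using A2 by (simp add: A2_def Let_def)

lemma compact_bound_F:
  assumes "compact K" "K \<subseteq> \<Theta>"
  obtains c where "\<And>x. x \<in> K \<Longrightarrow> F x \<le> c"
proof -
  have "bdd_above ((\<lambda>x. F x) ` K)"
    by (intro bounded_imp_bdd_above compact_imp_bounded compact_continuous_image
        continuous_on_subset[OF continuous_F] assms)
  then show ?thesis using that unfolding bdd_above_def by blast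
qed

text \<open>
  The supremum over all y in a fixed large ball dominates the gap over the unit ball around x and,
  as the set of test points does not move with x, is Lipschitz in x.
\<close>

definition wide_gap :: "real \<Rightarrow> real ^ 'n \<Rightarrow> real" where
  "wide_gap R x = (SUP y \<in> \<Theta> \<inter> cball 0 (R + 1). V_tilde blk m f p x y)"

section \<open>A Lipschitz majorant of the stationarity gap on a compact set\<close>

context
  fixes C R G L
  assumes C: "C \<subseteq> \<Theta>" "\<And>x. x \<in> C \<Longrightarrow> norm x \<le> R" and R: "0 \<le> R"
    and lip: "L-lipschitz_on (\<Theta> \<inter> cball 0 (2 * R + 2)) (grad UNIV f)"
      "L-lipschitz_on (\<Theta> \<inter> cball 0 (2 * R + 2)) p"
    and G0: "0 \<le> G" and G: "\<And>x. x \<in> C \<Longrightarrow> norm (grad UNIV f x) \<le> G"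
begin

text \<open>Replacing a block at most adds the norms, here R and R + 1. Such points leave C, which
  is why Lipschitz continuity is assumed on the ball of radius \<open>2 * R + 2\<close>.\<close>

lemma block_upd_in_ball:
  assumes "x \<in> C" "y \<in> \<Theta> \<inter> cball 0 (R + 1)" "i \<in> {1..m}"
  shows "block_upd blk x i y \<in> \<Theta> \<inter> cball 0 (2 * R + 2)"
proof -
  have "block_upd blk x i (block blk i y) \<in> \<Theta>"
    using assms C(1) by (intro block_upd_in_prod_set block_set) (auto simp: prod_set_def)
  then show ?thesis
    using norm_block_upd_le[of blk x i y] C(2)[OF assms(1)] assms(2) R by simp
qed

lemma in_ball:
  assumes "x \<in> C"
  shows "x \<in> \<Theta> \<inter> cball 0 (2 * R + 2)" "x \<in> \<Theta> \<inter> cball 0 (R + 1)"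
  using C(1) C(2)[OF assms] assms R by auto

lemma norm_diff_in_ball:
  assumes "x \<in> C" "y \<in> \<Theta> \<inter> cball 0 (R + 1)"
  shows "norm (y - x) \<le> 2 * R + 2"
  using norm_triangle_ineq4[of y x] C(2)[OF assms(1)] assms(2) by simp

text \<open>Serves to make the set bounded above whose real-valued supremum defines
  \<open>wide_gap\<close>.\<close>

lemma V_tilde_bound:
  assumes x: "x \<in> C" and y: "y \<in> \<Theta> \<inter> cball 0 (R + 1)"
  shows "V_tilde blk m f p x y \<le> (G + m * L) * (2 * R + 2)"
proof -
  have L0: "0 \<le> L" using lip(1) by (rule lipschitz_on_nonneg)
  have "(- grad UNIV f x) \<bullet> (y - x) \<le> norm (grad UNIV f x) * norm (y - x)"
    using norm_cauchy_schwarz[of "- grad UNIV f x" "y - x"] by simp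
  also have "\<dots> \<le> G * (2 * R + 2)"
    using G[OF x] norm_diff_in_ball[OF x y] order_trans[OF norm_ge_zero G[OF x]]
    by (intro mult_mono) auto
  finally have 1: "(- grad UNIV f x) \<bullet> (y - x) \<le> G * (2 * R + 2)" .
  have "p x - p (block_upd blk x i y) \<le> L * (2 * R + 2)" if i: "i \<in> {1..m}" for i
  proof -
    have eq: "x - block_upd blk x i y = - block blk i (y - x)" by (simp add: vec_eq_iff)
    have "p x - p (block_upd blk x i y) \<le> L * norm (x - block_upd blk x i y)"
      using lipschitz_onD[OF lip(2) in_ball(1)[OF x] block_upd_in_ball[OF x y i]]
      by (simp add: dist_norm)
    also have "\<dots> \<le> L * (2 * R + 2)"
      unfolding eq norm_minus_cancel using L0 norm_block_le norm_diff_in_ball[OF x y] order_trans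
      by (intro mult_left_mono) blast+
    finally show ?thesis .
  qed
  then have "(\<Sum>i=1..m. p x - p (block_upd blk x i y)) \<le> (\<Sum>i=1..m. L * (2 * R + 2))"
    by (rule sum_mono)
  with 1 show ?thesis by (simp add: V_tilde_def algebra_simps)
qed

lemma V_tilde_le_wide_gap:
  assumes x: "x \<in> C" and y: "y \<in> \<Theta> \<inter> cball 0 (R + 1)"
  shows "V_tilde blk m f p x y \<le> wide_gap R x"
  unfolding wide_gap_def by (intro cSUP_upper y bdd_aboveI2) (rule V_tilde_bound[OF x])

lemma wide_gap_nonneg: "x \<in> C \<Longrightarrow> 0 \<le> wide_gap R x"
  using V_tilde_le_wide_gap[of x x] in_ball by (simp add: V_tilde_def)

lemma wide_gap_least:
  assumes "x \<in> C" "\<And>y. y \<in> \<Theta> \<inter> cball 0 (R + 1) \<Longrightarrow> V_tilde blk m f p x y \<le> c"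
  shows "wide_gap R x \<le> c"
  unfolding wide_gap_def using assms in_ball(2)[OF assms(1)] by (intro cSUP_least) auto

lemma nash_gap_le_wide_gap:
  assumes x: "x \<in> C"
  shows "nash_gap blk m T f p x \<le> ereal (wide_gap R x)"
  unfolding nash_gap_def
proof (rule SUP_least)
  fix y assume "y \<in> {y \<in> \<Theta>. norm (y - x) \<le> 1}"
  then have "y \<in> \<Theta> \<inter> cball 0 (R + 1)"
    using norm_triangle_sub[of y x] C(2)[OF x] by auto
  then show "ereal (V_tilde blk m f p x y) \<le> ereal (wide_gap R x)"
    using V_tilde_le_wide_gap[OF x] by simp
qed

text \<open>For fixed y, \<open>V_tilde\<close> is Lipschitz in its base point with a constant
  independent of y, and this passes to the supremum. The three summands come from the change of the
  gradient, from the change of the base point in \<open>y - x\<close>, and from two values of p in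
  each block.\<close>

lemma lipschitz_wide_gap: "(L * (2 * R + 2) + G + m * (2 * L))-lipschitz_on C (wide_gap R)"
proof -
  have L0: "0 \<le> L" using lip(1) by (rule lipschitz_on_nonneg)
  let ?A = "L * (2 * R + 2) + G + m * (2 * L)"
  have V: "V_tilde blk m f p x y \<le> V_tilde blk m f p x' y + ?A * norm (x - x')"
    if x: "x \<in> C" and x': "x' \<in> C" and y: "y \<in> \<Theta> \<inter> cball 0 (R + 1)" for x x' y
  proof -
    let ?d = "norm (x - x')"
    have "(grad UNIV f x' - grad UNIV f x) \<bullet> (y - x) \<le>
        norm (grad UNIV f x' - grad UNIV f x) * norm (y - x)"
      by (rule norm_cauchy_schwarz)
    also have "\<dots> \<le> (L * ?d) * (2 * R + 2)"
      using lipschitz_onD[OF lip(1) in_ball(1)[OF x'] in_ball(1)[OF x]] norm_diff_in_ball[OF x y] L0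
      by (intro mult_mono) (auto simp: dist_norm norm_minus_commute)
    finally have 1: "(grad UNIV f x' - grad UNIV f x) \<bullet> (y - x) \<le> L * ?d * (2 * R + 2)" .
    have "grad UNIV f x' \<bullet> (x - x') \<le> norm (grad UNIV f x') * ?d"
      by (rule norm_cauchy_schwarz)
    also have "\<dots> \<le> G * ?d" using G[OF x'] by (intro mult_right_mono) auto
    finally have 2: "grad UNIV f x' \<bullet> (x - x') \<le> G * ?d" .
    have 3: "p x - p (block_upd blk x i y) \<le> p x' - p (block_upd blk x' i y) + 2 * L * ?d"
      if i: "i \<in> {1..m}" for i
    proof -
      have "p x - p x' \<le> L * ?d"
        using lipschitz_onD[OF lip(2) in_ball(1)[OF x] in_ball(1)[OF x']] by (simp add: dist_norm)
      moreover have "p (block_upd blk x' i y) - p (block_upd blk x i y) \<le> L * ?d"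
        using lipschitz_onD[OF lip(2) block_upd_in_ball[OF x y i] block_upd_in_ball[OF x' y i]]
          mult_left_mono[OF norm_block_upd_diff_le[of blk x i y x'] L0]
        by (simp add: dist_norm)
      ultimately show ?thesis by simp
    qed
    have "(\<Sum>i=1..m. p x - p (block_upd blk x i y)) \<le>
        (\<Sum>i=1..m. p x' - p (block_upd blk x' i y) + 2 * L * ?d)"
      by (intro sum_mono 3)
    then have "(\<Sum>i=1..m. p x - p (block_upd blk x i y)) \<le>
        (\<Sum>i=1..m. p x' - p (block_upd blk x' i y)) + m * (2 * L * ?d)"
      by (simp add: sum.distrib)
    with 1 2 show ?thesis
      by (simp add: V_tilde_def algebra_simps)
  qed
  have "wide_gap R x \<le> wide_gap R x' + ?A * norm (x - x')" if "x \<in> C" "x' \<in> C" for x x'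
    using V[OF that] V_tilde_le_wide_gap[OF that(2)] that(1)
    by (intro wide_gap_least) fastforce+
  then have "\<bar>wide_gap R x - wide_gap R x'\<bar> \<le> ?A * norm (x - x')" if "x \<in> C" "x' \<in> C" for x x'
    using that by (fastforce simp: norm_minus_commute abs_le_iff)
  then show ?thesis using L0 R G0 by (intro lipschitz_onI) (auto simp: dist_norm)
qed

end

text \<open>A, C and H depend on the problem, K and D alone; radii, \<open>Lg\<close>,
  \<open>\<rho>\<close> and the run are quantified afterwards. All later bounds can therefore be
  uniform over runs and explicit in \<open>Lg\<close> and \<open>\<rho>\<close>.\<close>

lemma descent_data_run:
  assumes K: "compact K" "K \<subseteq> \<Theta>"
  obtains A C H where "0 < A" "compact C" "C \<subseteq> \<Theta>" "A-lipschitz_on C H"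
    "\<And>x. x \<in> C \<Longrightarrow> nash_gap blk m T f p x \<le> ereal (H x)"
    "\<And>r Lg \<rho> \<theta> \<Delta>. bmm_dr_output blk m T f p r Lg \<rho> \<theta> \<Delta> \<Longrightarrow> \<theta> 0 \<in> K \<Longrightarrow>
       (\<Sum>n. \<Delta> (Suc n)) \<le> D \<Longrightarrow> range \<theta> \<subseteq> C \<and>
       (\<exists>e. descent_data A r Lg \<rho> (\<lambda>n. H (\<theta> n)) e (\<lambda>n. norm (\<theta> (Suc n) - \<theta> n)))"
proof -
  obtain a where a: "\<And>x. x \<in> K \<Longrightarrow> F x \<le> a" using compact_bound_F[OF K] by blast
  have "bdd_below ((\<lambda>x. F x) ` \<Theta>)" using A2 by (simp add: A2_def Let_def)
  then obtain l where l: "\<And>x. x \<in> \<Theta> \<Longrightarrow> l \<le> F x" unfolding bdd_below_def by blast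
  \<comment> \<open>The number a bounds F on K, and \<open>m * \<bar>D\<bar>\<close> bounds the
    total increase of F along a run.\<close>
  define C where "C = {x \<in> \<Theta>. F x \<le> a + m * \<bar>D\<bar>}"
  have C: "compact C" "C \<subseteq> \<Theta>" using compact_sublevel by (auto simp: C_def)
  obtain R where R: "0 < R" "\<And>x. x \<in> C \<Longrightarrow> norm x \<le> R"
    using compact_imp_bounded[OF C(1)] unfolding bounded_pos by blast
  have "compact (\<Theta> \<inter> cball 0 (2 * R + 2))" by (simp add: closed_Theta closed_Int_compact)
  then obtain L where lip: "L-lipschitz_on (\<Theta> \<inter> cball 0 (2 * R + 2)) (grad UNIV f)"
      "L-lipschitz_on (\<Theta> \<inter> cball 0 (2 * R + 2)) p"
    using compact_lipschitz by blast
  have L0: "0 \<le> L" using lip(1) by (rule lipschitz_on_nonneg)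
  have "continuous_on C (grad UNIV f)"
    using A2 C(2) continuous_on_subset by (auto simp: A2_def Let_def)
  then have "bounded (grad UNIV f ` C)"
    using C(1) by (intro compact_imp_bounded compact_continuous_image)
  then obtain G where G: "0 < G" "\<And>x. x \<in> C \<Longrightarrow> norm (grad UNIV f x) \<le> G"
    unfolding bounded_pos by blast
  define P where "P = 2 * R + 2"
  \<comment> \<open>A sum of nonnegative terms that dominates every constant at once: 8 from
    quadratic growth, the errors of the test point, the factor P, the total decrease, the Lipschitz
    constant of the gap, and m from the step lengths.\<close>
  define A where "A = 9 + m * P + m * (L * (P + 2)) + P + (\<bar>a\<bar> + \<bar>l\<bar> + 2 * m * \<bar>D\<bar>) +
    (L * (2 * R + 2) + G + m * (2 * L)) + m"
  have P: "2 \<le> P" using R(1) by (simp add: P_def)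
  have nn: "0 \<le> real m * P" "0 \<le> real m * (L * (P + 2))" "0 \<le> 2 * m * \<bar>D\<bar>" "0 \<le> L * (2 * R + 2)"
    "0 \<le> real m * (2 * L)" using P L0 R(1) by simp_all
  have A: "8 \<le> A" "m * P \<le> A" "m * (L * (P + 2)) \<le> A" "P \<le> A" "a - l + 2 * m * \<bar>D\<bar> \<le> A"
    "L * (2 * R + 2) + G + m * (2 * L) \<le> A" "m \<le> A" "0 < A"
    unfolding A_def using nn P G(1) abs_ge_self[of a] abs_ge_minus_self[of l] of_nat_0_le_iff[of m]
    by linarith+
  note wide = C(2) R(2) less_imp_le[OF R(1)] lip less_imp_le[OF G(1)] G(2)
  have run: "range \<theta> \<subseteq> C \<and>
       (\<exists>e. descent_data A r Lg \<rho> (\<lambda>n. wide_gap R (\<theta> n)) e (\<lambda>n. norm (\<theta> (Suc n) - \<theta> n)))"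
    if out: "bmm_dr_output blk m T f p r Lg \<rho> \<theta> \<Delta>" and K0: "\<theta> 0 \<in> K" and D: "(\<Sum>n. \<Delta> (Suc n)) \<le> D"
    for r Lg \<rho> \<theta> \<Delta>
  proof -
    from out obtain g \<theta>s where "bmm_dr blk m T f r \<rho> g \<theta>" "exact_updates blk m T p r g \<theta> \<theta>s"
        "\<forall>n\<ge>1. \<Delta> n = optimality_gap blk m p g \<theta> \<theta>s n" "A3 blk m T r Lg \<rho> g" "A4 \<Delta>"
      unfolding bmm_dr_output_def by blast
    then interpret bmm_run blk m T f p r Lg \<rho> g \<theta> \<theta>s \<Delta>
      by unfold_locales auto
    have sumD: "(\<Sum>k<N. \<Delta> (Suc k)) \<le> \<bar>D\<bar>" for N using sum_gap_le[of N] D by linarith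
    have mid_C: "mid (Suc n) (Suc i) \<in> C" if "i \<le> m" for n i
    proof -
      have "m * (\<Sum>k. \<Delta> (Suc k)) \<le> m * \<bar>D\<bar>" using D by (intro mult_left_mono) auto
      then show ?thesis
        using F_mid_bound[of "Suc n" i] that a[OF K0] mid_in by (simp add: C_def)
    qed
    \<comment> \<open>Every iterate, the initial one included, is the intermediate point before
      block 1 of the next iteration.\<close>
    have it_C: "\<theta> n \<in> C" for n
      using mid_C[of 0 n] mid_first[of "Suc n"] by simp
    \<comment> \<open>The multiple 2 of the gap is dictated by \<open>step_strongly_convex\<close>;
      the test point and nonnegativity need only 1.\<close>
    define e where "e n = F (\<theta> n) - F (\<theta> (Suc n)) + 2 * m * \<Delta> (Suc n)" for n
    have m\<Delta>: "0 \<le> m * \<Delta> (Suc n)" for n using gap_nonneg by simp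
    have e_ge: "F (\<theta> n) - F (\<theta> (Suc n)) + m * \<Delta> (Suc n) \<le> e n" for n
      using m\<Delta>[of n] by (simp add: e_def)
    have e0: "0 \<le> e n" for n using m\<Delta>[of n] F_iterate_Suc[of n] by (simp add: e_def)
    have key: "b * wide_gap R (\<theta> n) \<le> A * e n + A * Lg * b\<^sup>2 + A * b * norm (\<theta> (Suc n) - \<theta> n)"
      (is "_ \<le> ?X") if b: "0 \<le> b" "b \<le> 1" "ereal b \<le> r (Suc n)" for n b
    proof (cases "b = 0")
      case True
      then show ?thesis using e0 A(8) by simp
    next
      case False
      with b have b0: "0 < b" by simp
      have "b * V_tilde blk m f p (\<theta> n) y \<le> ?X" if y: "y \<in> \<Theta> \<inter> cball 0 (R + 1)" for y
      proof -
        let ?d = "norm (\<theta> (Suc n) - \<theta> n)"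
        have mid: "mid (Suc n) i \<in> C" if "i \<in> {1..m}" for i
          using mid_C[of "i - 1" n] that by (auto simp: Suc_diff_1)
        \<comment> \<open>Test points may be as far as P away, so the weight is
          \<open>b / P\<close>: the test step then has length at most b, as the radius allows.
          Multiplication by P restores the weight b.\<close>
        have "b / P * V_tilde blk m f p (\<theta> n) y \<le>
            F (\<theta> n) - F (\<theta> (Suc n)) + m * \<Delta> (Suc n) + m * (Lg * (b / P)\<^sup>2 * P\<^sup>2) +
            b / P * (m * (L * (P + 2) * ?d))"
        proof (rule test_point[of "Suc n" y "b / P" P, simplified diff_Suc_1])
          show "b / P \<le> 1" using b P by (simp add: field_simps)
          show "\<theta> n \<in> \<Theta> \<inter> cball 0 (2 * R + 2)" by (rule in_ball(1)[OF wide it_C])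
          show "mid (Suc n) i \<in> \<Theta> \<inter> cball 0 (2 * R + 2) \<and>
              block_upd blk (mid (Suc n) i) i y \<in> \<Theta> \<inter> cball 0 (2 * R + 2) \<and>
              block_upd blk (\<theta> n) i y \<in> \<Theta> \<inter> cball 0 (2 * R + 2) \<and> norm (y - mid (Suc n) i) \<le> P"
            if i: "i \<in> {1..m}" for i
            using in_ball(1)[OF wide mid[OF i]] block_upd_in_ball[OF wide mid[OF i] y i]
              block_upd_in_ball[OF wide it_C y i] norm_diff_in_ball[OF wide mid[OF i] y]
            unfolding P_def by blast
        qed (use b P y lip in auto)
        then have "P * (b / P * V_tilde blk m f p (\<theta> n) y) \<le> P * (e n + m * (Lg * (b / P)\<^sup>2 * P\<^sup>2) +
            b / P * (m * (L * (P + 2) * ?d)))"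
          using e_ge[of n] P by (intro mult_left_mono) auto
        moreover have "P * (e n + m * (Lg * (b / P)\<^sup>2 * P\<^sup>2) + b / P * (m * (L * (P + 2) * ?d))) =
            P * e n + m * P * (Lg * b\<^sup>2) + m * (L * (P + 2)) * (b * ?d)"
          using P by (simp add: distrib_left power_divide mult_ac)
        ultimately have "b * V_tilde blk m f p (\<theta> n) y \<le>
            P * e n + m * P * (Lg * b\<^sup>2) + m * (L * (P + 2)) * (b * ?d)"
          using P by simp
        also have "\<dots> \<le> A * e n + A * (Lg * b\<^sup>2) + A * (b * ?d)"
          using A e0 Lg_pos b by (intro add_mono mult_right_mono) auto
        finally show ?thesis by (simp add: mult.assoc)
      qed
      then have "wide_gap R (\<theta> n) \<le> ?X / b"
        using b0 by (intro wide_gap_least[OF wide it_C]) (auto simp: field_simps)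
      then show ?thesis using b0 by (simp add: field_simps)
    qed
    have "descent_data A r Lg \<rho> (\<lambda>n. wide_gap R (\<theta> n)) e (\<lambda>n. norm (\<theta> (Suc n) - \<theta> n))"
      unfolding descent_data_def
    proof (intro conjI allI impI)
      fix N
      have "(\<Sum>k<N. e k) = F (\<theta> 0) - F (\<theta> N) + 2 * m * (\<Sum>k<N. \<Delta> (Suc k))"
        using sum_lessThan_telescope'[of "\<lambda>n. F (\<theta> n)" N]
        by (simp add: e_def sum.distrib sum_distrib_left)
      also have "\<dots> \<le> a - l + 2 * m * \<bar>D\<bar>"
        using a[OF K0] l[OF iterate_in[of N]] mult_left_mono[OF sumD[of N], of "2 * real m"] by simp
      finally show "(\<Sum>k<N. e k) \<le> A" using A(5) by simp
    next
      fix n s assume s: "r (Suc n) = ereal s"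
      then have "0 \<le> s" using r_pos[of "Suc n"] by simp
      then have "m * s \<le> A * s" using A(7) by (rule mult_right_mono[rotated])
      then show "norm (\<theta> (Suc n) - \<theta> n) \<le> A * s" using step_radius[of "Suc n" s] s by simp
    next
      fix n
      have "8 * e n \<le> A * e n" using A(1) e0 by (rule mult_right_mono)
      then show "\<rho> * (norm (\<theta> (Suc n) - \<theta> n))\<^sup>2 \<le> A * e n"
        using step_strongly_convex[of "Suc n"] by (simp add: e_def)
    qed (use key e0 wide_gap_nonneg[OF wide it_C] in auto)
    then show ?thesis using it_C by blast
  qed
  show thesis
  proof (rule that[OF A(8) C])
    show "A-lipschitz_on C (wide_gap R)"
      using lipschitz_wide_gap[OF wide] A(6) by (rule lipschitz_on_le)
    show "nash_gap blk m T f p x \<le> ereal (wide_gap R x)" if "x \<in> C" for x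
      using nash_gap_le_wide_gap[OF wide that] .
  qed (rule run)
qed

end

section \<open>Rates\<close>

text \<open>The smallest h k times the total weight is at most the weighted sum; Y may be any
  positive lower bound of the total weight.\<close>

lemma exists_le_weighted_mean:
  fixes h b :: "nat \<Rightarrow> real"
  assumes n: "1 \<le> n" and h: "\<And>k. 0 \<le> h k" and b: "\<And>k. k \<in> {1..n} \<Longrightarrow> 0 \<le> b k"
    and X: "(\<Sum>k=1..n. b k * h k) \<le> X" and Y: "0 < Y" "Y \<le> (\<Sum>k=1..n. b k)"
  shows "\<exists>k\<in>{1..n}. h k \<le> X / Y"
proof -
  obtain k where k: "k \<in> {1..n}" "\<And>j. j \<in> {1..n} \<Longrightarrow> h k \<le> h j"
    using ex_min_if_finite[of "h ` {1..n}"] n by (fastforce simp: not_less)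
  have "h k * Y \<le> h k * (\<Sum>j=1..n. b j)" using Y(2) h by (intro mult_left_mono)
  also have "\<dots> = (\<Sum>j=1..n. b j * h k)" by (simp add: sum_distrib_left mult.commute)
  also have "\<dots> \<le> (\<Sum>j=1..n. b j * h j)" using k(2) b by (intro sum_mono mult_left_mono) auto
  finally have "h k * Y \<le> X" using X by simp
  then show ?thesis using k(1) Y(1) by (auto simp: field_simps)
qed

text \<open>AM-GM decouples the step length, whose squares are summable.\<close>

lemma descent_data_strongly_convex:
  assumes dd: "descent_data A r Lg \<rho> h e d" and A: "0 < A" and \<rho>: "0 < \<rho>"
    and b: "0 \<le> b" "b \<le> 1" "ereal b \<le> r (Suc n)"
  shows "b * h n \<le> (A + A\<^sup>2) * e n + A * (Lg + 1 / \<rho>) * b\<^sup>2"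
proof -
  have "0 \<le> (b - \<rho> * d n)\<^sup>2 + b\<^sup>2 + (\<rho> * d n)\<^sup>2" by simp
  then have "\<rho> * (b * d n) \<le> \<rho> * (b\<^sup>2 / \<rho> + \<rho> * (d n)\<^sup>2)"
    using \<rho> by (simp add: power2_eq_square algebra_simps)
  then have "b * d n \<le> b\<^sup>2 / \<rho> + \<rho> * (d n)\<^sup>2" using \<rho> by simp
  also have "\<dots> \<le> b\<^sup>2 / \<rho> + A * e n" using dd by (simp add: descent_data_def)
  finally have "A * (b * d n) \<le> A * (b\<^sup>2 / \<rho> + A * e n)" using A by simp
  moreover have "b * h n \<le> A * e n + A * Lg * b\<^sup>2 + A * b * d n"
    using dd b by (simp add: descent_data_def)
  ultimately show ?thesis by (simp add: algebra_simps power2_eq_square)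
qed

lemma descent_data_sum_le:
  assumes "descent_data A r Lg \<rho> h e d"
  shows "(\<Sum>k=1..n. e k) \<le> A"
proof -
  have "(\<Sum>k=1..n. e k) \<le> (\<Sum>k<Suc n. e k)"
    using assms by (intro sum_mono2) (auto simp: descent_data_def)
  then show ?thesis using assms order_trans unfolding descent_data_def by blast
qed

lemma descent_data_summable:
  assumes "descent_data A r Lg \<rho> h e d"
  shows "summable e"
  using assms by (intro summableI_nonneg_bounded[of e A]) (auto simp: descent_data_def)

lemma rate_unconstrained:
  assumes dd: "descent_data A r Lg \<rho> h e d" and A: "0 < A" and \<rho>: "0 < \<rho>" and Lg: "0 < Lg"
    and r: "\<And>n. n \<ge> 1 \<Longrightarrow> r n = \<infinity>" and n: "1 \<le> n"
  shows "\<exists>k\<in>{1..n}. h k \<le> (A + A\<^sup>2 + A ^ 3) * sqrt ((1 + Lg + 1 / \<rho>) / n)"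
proof -
  define Q where "Q = 1 + Lg + 1 / \<rho>"
  have Q: "1 \<le> Q" using \<rho> Lg by (simp add: Q_def)
  \<comment> \<open>Chosen so that \<open>n * b\<^sup>2 * Q = 1\<close>: the quadratic errors sum to
    at most A, which balances them against the total decrease. As \<open>n * Q\<close> is at least
    1, b is an admissible weight.\<close>
  define b where "b = 1 / sqrt (n * Q)"
  have nQ: "1 \<le> n * Q" using n Q by (metis mult_mono' mult_1 of_nat_1 of_nat_mono zero_le_one)
  have b: "0 < b" "b \<le> 1" "b\<^sup>2 * (n * Q) = 1"
    using nQ n by (auto simp: b_def power_divide)
  have "(\<Sum>k=1..n. b * h k) \<le> (\<Sum>k=1..n. (A + A\<^sup>2) * e k + A * (Lg + 1 / \<rho>) * b\<^sup>2)"
    using b r by (intro sum_mono descent_data_strongly_convex[OF dd A \<rho>]) auto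
  also have "\<dots> = (A + A\<^sup>2) * (\<Sum>k=1..n. e k) + A * ((Lg + 1 / \<rho>) * (b\<^sup>2 * n))"
    by (simp add: sum.distrib sum_distrib_left)
  also have "\<dots> \<le> (A + A\<^sup>2) * A + A * 1"
  proof (intro add_mono mult_left_mono descent_data_sum_le[OF dd])
    have "(Lg + 1 / \<rho>) * (b\<^sup>2 * n) \<le> Q * (b\<^sup>2 * n)"
      by (intro mult_right_mono) (auto simp: Q_def)
    then show "(Lg + 1 / \<rho>) * (b\<^sup>2 * n) \<le> 1" using b(3) by (simp add: mult.commute mult.left_commute)
  qed (use A in auto)
  also have "\<dots> = A + A\<^sup>2 + A ^ 3" by (simp add: power2_eq_square power3_eq_cube algebra_simps)
  finally have "\<exists>k\<in>{1..n}. h k \<le> (A + A\<^sup>2 + A ^ 3) / (n * b)"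
    using b n dd by (intro exists_le_weighted_mean[of n h "\<lambda>_. b"]) (auto simp: descent_data_def)
  moreover have "1 / (n * b) = sqrt (Q / n)"
    using n Q by (simp add: b_def real_sqrt_mult real_sqrt_divide field_simps flip: power2_eq_square)
  ultimately show ?thesis by (metis Q_def divide_inverse inverse_eq_divide)
qed

section \<open>Rates and convergence under square-summable radii\<close>

context
  fixes A Lg \<rho> :: real and r :: "nat \<Rightarrow> ereal" and h e d s :: "nat \<Rightarrow> real"
  assumes dd: "descent_data A r Lg \<rho> h e d" and A: "0 < A" and Lg: "0 < Lg"
    and r: "\<And>n. n \<ge> 1 \<Longrightarrow> r n = ereal (s n)" and s: "\<And>n. n \<ge> 1 \<Longrightarrow> 0 < s n"
    and S: "summable (\<lambda>n. (s (Suc n))\<^sup>2)"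
begin

abbreviation "S2 \<equiv> (\<Sum>n. (s (Suc n))\<^sup>2)"

lemma sum_radii_squared_le: "(\<Sum>k=1..n. (s (Suc k))\<^sup>2) \<le> S2"
  by (rule sum_le_suminf[OF S]) auto

lemma S2_nonneg: "0 \<le> S2"
  by (rule suminf_nonneg[OF S]) simp

text \<open>From s \<le> 1 + s * s. Division by \<open>1 + S2\<close> thus turns the radii into
  weights of at most 1.\<close>

lemma radius_le: "n \<ge> 1 \<Longrightarrow> s n \<le> 1 + S2"
proof -
  assume "n \<ge> 1"
  then have "(s n)\<^sup>2 \<le> S2" using sum_le_suminf[OF S, of "{n - 1}"] by simp
  moreover have "0 \<le> (s n - 1)\<^sup>2 + (s n)\<^sup>2 + 1" by simp
  ultimately show ?thesis by (simp add: power2_eq_square algebra_simps)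
qed

text \<open>The step is at most A times the radius, so its product with b is bounded by the squared
  radius. This covers \<open>\<rho> = 0\<close>, and \<open>Lg\<close> multiplies only
  \<open>b\<^sup>2\<close>.\<close>

lemma descent_radius:
  assumes b: "0 \<le> b" "b \<le> 1" "b \<le> s (Suc n)"
  shows "b * h n \<le> A * e n + A * Lg * b\<^sup>2 + A\<^sup>2 * (s (Suc n))\<^sup>2"
proof -
  have "0 \<le> d n" "d n \<le> A * s (Suc n)" using dd r[of "Suc n"] by (auto simp: descent_data_def)
  then have "b * d n \<le> s (Suc n) * (A * s (Suc n))" using b by (intro mult_mono) auto
  then have "A * (b * d n) \<le> A * (s (Suc n) * (A * s (Suc n)))" using A by simp
  moreover have "b * h n \<le> A * e n + A * Lg * b\<^sup>2 + A * b * d n"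
    using dd b r[of "Suc n"] by (simp add: descent_data_def)
  ultimately show ?thesis by (simp add: power2_eq_square mult_ac)
qed

lemma sum_descent_radius:
  assumes "\<And>k. k \<in> {1..n} \<Longrightarrow> 0 \<le> b k \<and> b k \<le> 1 \<and> b k \<le> s (Suc k)"
  shows "(\<Sum>k=1..n. b k * h k) \<le> A\<^sup>2 + A * Lg * (\<Sum>k=1..n. (b k)\<^sup>2) + A\<^sup>2 * S2"
proof -
  have "(\<Sum>k=1..n. b k * h k) \<le> (\<Sum>k=1..n. A * e k + A * Lg * (b k)\<^sup>2 + A\<^sup>2 * (s (Suc k))\<^sup>2)"
    using assms by (intro sum_mono descent_radius) auto
  also have "\<dots> = A * (\<Sum>k=1..n. e k) + A * Lg * (\<Sum>k=1..n. (b k)\<^sup>2) + A\<^sup>2 * (\<Sum>k=1..n. (s (Suc k))\<^sup>2)"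
    by (simp add: sum.distrib sum_distrib_left)
  also have "\<dots> \<le> A * A + A * Lg * (\<Sum>k=1..n. (b k)\<^sup>2) + A\<^sup>2 * S2"
    using A Lg descent_data_sum_le[OF dd] sum_radii_squared_le by (intro add_mono mult_left_mono) auto
  finally show ?thesis by (simp add: power2_eq_square)
qed

lemma rate_radii:
  assumes n: "2 \<le> n"
  shows "\<exists>k\<in>{1..n}. h k \<le> (A\<^sup>2 + A * S2 + A\<^sup>2 * S2) * (1 + Lg) * (1 + S2) * ((s 1 + s 2) / s 2)
    / (\<Sum>k=1..n. s k)"
proof -
  let ?b = "\<lambda>k. s (Suc k) / (1 + S2)"
  let ?X = "(A\<^sup>2 + A * S2 + A\<^sup>2 * S2) * (1 + Lg)"
  have b: "0 \<le> ?b k \<and> ?b k \<le> 1 \<and> ?b k \<le> s (Suc k)" for k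
    using s[of "Suc k"] radius_le[of "Suc k"] S2_nonneg by (auto simp: field_simps)
  have "(\<Sum>k=1..n. (?b k)\<^sup>2) \<le> (\<Sum>k=1..n. (s (Suc k))\<^sup>2)"
    using b by (intro sum_mono power_mono) auto
  then have "(\<Sum>k=1..n. (?b k)\<^sup>2) \<le> S2" using sum_radii_squared_le[of n] by simp
  then have "A * Lg * (\<Sum>k=1..n. (?b k)\<^sup>2) \<le> A * Lg * S2" using A Lg by simp
  moreover have "(\<Sum>k=1..n. ?b k * h k) \<le> A\<^sup>2 + A * Lg * (\<Sum>k=1..n. (?b k)\<^sup>2) + A\<^sup>2 * S2"
    using b by (intro sum_descent_radius) blast
  moreover have "A\<^sup>2 + A * Lg * S2 + A\<^sup>2 * S2 \<le> ?X"
    using A Lg S2_nonneg by (simp add: algebra_simps)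
  ultimately have X: "(\<Sum>k=1..n. ?b k * h k) \<le> ?X" by linarith
  define W where "W = (\<Sum>k=2..n. s k)"
  have W1: "(\<Sum>k=1..n. s k) = s 1 + W"
    using n by (simp add: W_def sum.atLeast_Suc_atMost numeral_2_eq_2)
  have "W \<le> (\<Sum>k=2..Suc n. s k)"
    unfolding W_def using s[THEN less_imp_le] by (intro sum_mono2) auto
  also have "\<dots> = (\<Sum>k=1..n. s (Suc k))"
    using sum.shift_bounds_cl_Suc_ivl[of s 1 n] by (simp add: numeral_2_eq_2)
  finally have W2: "W \<le> (\<Sum>k=1..n. s (Suc k))" .
  have W3: "s 2 \<le> W"
    unfolding W_def using n s[THEN less_imp_le] by (intro member_le_sum) auto
  have s12: "0 < s 1" "0 < s 2" using s by auto
  \<comment> \<open>The available weights are radii 2 to n + 1, whereas the claim has radii 1 to n.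
    Since W is at least \<open>s 2\<close>, restoring \<open>s 1\<close> enlarges W by a factor of
    at most \<open>(s 1 + s 2) / s 2\<close>.\<close>
  let ?Y = "(s 2 / (s 1 + s 2)) * (\<Sum>k=1..n. s k) / (1 + S2)"
  have "s 2 * (s 1 + W) \<le> W * (s 1 + s 2)" using mult_right_mono[OF W3, of "s 1"] s12
    by (simp add: algebra_simps)
  then have "(s 2 / (s 1 + s 2)) * (\<Sum>k=1..n. s k) \<le> W"
    unfolding W1 using s12 by (simp add: field_simps)
  with W2 have "?Y \<le> (\<Sum>k=1..n. s (Suc k)) / (1 + S2)"
    using S2_nonneg by (intro divide_right_mono) auto
  then have "?Y \<le> (\<Sum>k=1..n. ?b k)" by (simp add: sum_divide_distrib)
  moreover have "0 < ?Y" unfolding W1 using W3 s12 S2_nonneg by simp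
  ultimately have "\<exists>k\<in>{1..n}. h k \<le> ?X / ?Y"
    using n b X dd by (intro exists_le_weighted_mean) (auto simp: descent_data_def)
  moreover have "?X / ?Y = ?X * (1 + S2) * ((s 1 + s 2) / s 2) / (\<Sum>k=1..n. s k)"
    using s12 S2_nonneg by (simp add: field_simps)
  ultimately show ?thesis by (simp only:)
qed

text \<open>The condition on \<open>b\<^sup>2\<close> absorbs \<open>Lg\<close> into a bounded
  error, so that \<open>Lg\<close> survives only through the choice of b.\<close>

lemma rate_constant_weight:
  assumes n: "1 \<le> n" and b: "0 < b" "b\<^sup>2 * (n * (1 + Lg)) \<le> 1" "\<And>k. k \<in> {1..n} \<Longrightarrow> b \<le> s (Suc k)"
  shows "\<exists>k\<in>{1..n}. h k \<le> (A + A\<^sup>2 + A\<^sup>2 * S2) / (n * b)"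
proof -
  have "b\<^sup>2 * 1 \<le> b\<^sup>2 * (n * (1 + Lg))"
    using n Lg mult_mono[of 1 "real n" 1 "1 + Lg"] by (intro mult_left_mono) auto
  then have "b\<^sup>2 \<le> 1" using b(2) by simp
  then have b1: "b \<le> 1" using b(1) by (simp add: abs_square_le_1)
  have "(\<Sum>k=1..n. b * h k) \<le> A\<^sup>2 + A * Lg * (\<Sum>k=1..n. b\<^sup>2) + A\<^sup>2 * S2"
    using b b1 by (intro sum_descent_radius) auto
  also have "\<dots> = A\<^sup>2 + A * (Lg * (b\<^sup>2 * n)) + A\<^sup>2 * S2" by simp
  also have "\<dots> \<le> A\<^sup>2 + A * 1 + A\<^sup>2 * S2"
  proof (intro add_mono mult_left_mono order_refl)
    have "Lg * (b\<^sup>2 * n) \<le> b\<^sup>2 * (n * (1 + Lg))" by (simp add: algebra_simps)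
    with b(2) show "Lg * (b\<^sup>2 * n) \<le> 1" by simp
  qed (use A in auto)
  finally show ?thesis
    using b n dd by (intro exists_le_weighted_mean[of n h "\<lambda>_. b"]) (auto simp: descent_data_def)
qed

text \<open>
  The increments of \<open>h\<^sup>2\<close> are at most \<open>s * (2 * h + s)\<close> up to constants, so \<open>h\<^sup>2\<close> converges;
  a positive limit is excluded by the summability of \<open>s * h\<close>.
\<close>

lemma gaps_tendsto_zero_radii:
  assumes lip: "\<And>n. \<bar>h (Suc n) - h n\<bar> \<le> A * d n" and div: "\<not> summable (\<lambda>n. s (Suc n))"
  shows "h \<longlonglongrightarrow> 0"
proof -
  let ?s = "\<lambda>n. s (Suc n)"
  have s0: "0 < ?s n" for n using s by simp
  have h0: "0 \<le> h n" for n using dd by (simp add: descent_data_def)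
  have sh: "summable (\<lambda>n. ?s n * h n)"
  proof (rule summable_comparison_test')
    let ?c = "1 + S2"
    show "summable (\<lambda>n. ?c * (A * e n + (A * Lg + A\<^sup>2) * (?s n)\<^sup>2))"
      by (intro summable_mult summable_add S descent_data_summable[OF dd])
    fix n :: nat
    have b: "0 \<le> ?s n / ?c" "?s n / ?c \<le> 1" "?s n / ?c \<le> ?s n"
      using s0[of n] radius_le[of "Suc n"] S2_nonneg by (auto simp: field_simps)
    have "(?s n / ?c) * h n \<le> A * e n + A * Lg * (?s n / ?c)\<^sup>2 + A\<^sup>2 * (?s n)\<^sup>2"
      by (rule descent_radius[OF b])
    also have "\<dots> \<le> A * e n + A * Lg * (?s n)\<^sup>2 + A\<^sup>2 * (?s n)\<^sup>2"
      using b A Lg by (intro add_mono mult_left_mono power_mono order_refl) auto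
    finally show "norm (?s n * h n) \<le> ?c * (A * e n + (A * Lg + A\<^sup>2) * (?s n)\<^sup>2)"
      using S2_nonneg s0[of n] h0[of n] by (simp add: field_simps)
  qed
  have "summable (\<lambda>n. (h (Suc n))\<^sup>2 - (h n)\<^sup>2)"
  proof (rule summable_comparison_test')
    show "summable (\<lambda>n. 2 * A\<^sup>2 * (?s n * h n) + (A\<^sup>2)\<^sup>2 * (?s n)\<^sup>2)"
      by (intro summable_mult summable_add S sh)
    fix n :: nat
    have "d n \<le> A * ?s n" using dd r[of "Suc n"] by (simp add: descent_data_def)
    then have "A * d n \<le> A\<^sup>2 * ?s n" using A by (simp add: power2_eq_square mult.assoc)
    then have inc: "\<bar>h (Suc n) - h n\<bar> \<le> A\<^sup>2 * ?s n" using lip[of n] by linarith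
    have "\<bar>(h (Suc n))\<^sup>2 - (h n)\<^sup>2\<bar> = \<bar>h (Suc n) - h n\<bar> * (h (Suc n) + h n)"
      using h0[of n] h0[of "Suc n"] abs_mult[of "h (Suc n) - h n" "h (Suc n) + h n"]
      by (simp add: power2_eq_square algebra_simps)
    also have "\<dots> \<le> (A\<^sup>2 * ?s n) * (2 * h n + A\<^sup>2 * ?s n)"
      using inc h0[of n] h0[of "Suc n"] s0[of n] by (intro mult_mono) auto
    finally show "norm ((h (Suc n))\<^sup>2 - (h n)\<^sup>2) \<le> 2 * A\<^sup>2 * (?s n * h n) + (A\<^sup>2)\<^sup>2 * (?s n)\<^sup>2"
      by (simp add: algebra_simps power2_eq_square)
  qed
  then have "convergent (\<lambda>n. (h n)\<^sup>2 - (h 0)\<^sup>2)"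
    by (simp add: summable_iff_convergent sum_lessThan_telescope[of "\<lambda>n. (h n)\<^sup>2"])
  then obtain l where "(\<lambda>n. (h n)\<^sup>2 - (h 0)\<^sup>2) \<longlonglongrightarrow> l" by (auto simp: convergent_def)
  from tendsto_add[OF this tendsto_const[of "(h 0)\<^sup>2"]]
  have "(\<lambda>n. sqrt ((h n)\<^sup>2)) \<longlonglongrightarrow> sqrt (l + (h 0)\<^sup>2)"
    by (intro tendsto_real_sqrt) simp
  then obtain q where q: "h \<longlonglongrightarrow> q" using h0 by auto
  have "q = 0"
  proof (rule ccontr)
    assume "q \<noteq> 0"
    moreover have "0 \<le> q" using q h0 by (intro LIMSEQ_le_const[OF q]) auto
    ultimately have q0: "0 < q" by simp
    then have "\<forall>\<^sub>F n in sequentially. q / 2 < h n" using q by (intro order_tendstoD) auto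
    then have "\<forall>\<^sub>F n in sequentially. norm (?s n) \<le> 2 / q * (?s n * h n)"
    proof eventually_elim
      case (elim n)
      then have "?s n * (q / 2) \<le> ?s n * h n" using s0[of n] by (intro mult_left_mono) auto
      then show ?case using q0 s0[of n] by (simp add: field_simps)
    qed
    from summable_comparison_test_ev[OF this summable_mult[OF sh]] div show False by simp
  qed
  with q show ?thesis by simp
qed

end

text \<open>For a fixed weight b the decrease e n tends to 0, so h is eventually at most a constant
  times b, up to any tolerance; with infinite radii b may be taken arbitrarily small and still be
  kept fixed along the run.\<close>

lemma gaps_tendsto_zero_unconstrained:
  assumes dd: "descent_data A r Lg \<rho> h e d" and A: "0 < A" and \<rho>: "0 < \<rho>" and Lg: "0 < Lg"
    and r: "\<And>n. n \<ge> 1 \<Longrightarrow> r n = \<infinity>"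
  shows "h \<longlonglongrightarrow> 0"
proof (rule LIMSEQ_I)
  fix \<epsilon> :: real assume \<epsilon>: "0 < \<epsilon>"
  define Q where "Q = A * (Lg + 1 / \<rho>)"
  have Q: "0 < Q" using A \<rho> Lg by (simp add: Q_def add_pos_pos)
  define b where "b = min 1 (\<epsilon> / (2 * Q))"
  have b: "0 < b" "b \<le> 1" "Q * b \<le> \<epsilon> / 2"
    using \<epsilon> Q by (auto simp: b_def min_def field_simps)
  have "(\<lambda>n. (A + A\<^sup>2) * e n) \<longlonglongrightarrow> 0"
    using summable_LIMSEQ_zero[OF descent_data_summable[OF dd]] by (rule tendsto_mult_right_zero)
  moreover have "0 < b * \<epsilon> / 2" using b \<epsilon> by simp
  ultimately have "\<forall>\<^sub>F n in sequentially. (A + A\<^sup>2) * e n < b * \<epsilon> / 2" by (rule order_tendstoD)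
  then obtain N where N: "\<And>n. n \<ge> N \<Longrightarrow> (A + A\<^sup>2) * e n < b * \<epsilon> / 2"
    by (auto simp: eventually_sequentially)
  have "norm (h n - 0) < \<epsilon>" if "n \<ge> N" for n
  proof -
    have "b * h n \<le> (A + A\<^sup>2) * e n + b * (Q * b)"
      using descent_data_strongly_convex[OF dd A \<rho>, of b n] b r
      by (simp add: Q_def power2_eq_square mult_ac)
    also have "\<dots> < b * \<epsilon> / 2 + b * (\<epsilon> / 2)"
      using N[OF that] b by (intro add_less_le_mono mult_left_mono) auto
    also have "\<dots> = b * \<epsilon>" by simp
    finally have "h n < \<epsilon>" using b(1) mult_less_cancel_left_pos by blast
    then show ?thesis using dd by (simp add: descent_data_def)
  qed
  then show "\<exists>N. \<forall>n\<ge>N. norm (h n - 0) < \<epsilon>" by blast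
qed

text \<open>A finite sum of squares in the extended reals forces every radius to be finite, so the
  radii can be replaced by positive reals; otherwise the other alternative of \<open>A3\<close> must
  hold.\<close>

lemma radii_cases:
  fixes s :: "nat \<Rightarrow> real"
  assumes "A3 blk m T r Lg \<rho> g" and r: "\<And>n. n \<ge> 1 \<Longrightarrow> 0 < r n"
    and s: "\<And>n. s n = real_of_ereal (r n)"
  obtains (radii) "\<And>n. n \<ge> 1 \<Longrightarrow> r n = ereal (s n)" "\<And>n. n \<ge> 1 \<Longrightarrow> 0 < s n"
      "summable (\<lambda>n. (s (Suc n))\<^sup>2)"
    | (unconstrained) "\<And>n. n \<ge> 1 \<Longrightarrow> r n = \<infinity>" "0 < \<rho>"
proof (cases "(\<Sum>n. (r (Suc n))\<^sup>2) < \<infinity>")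
  case True
  have sq: "0 \<le> (r n)\<^sup>2" for n :: nat
    by (cases "r n") (simp_all add: power2_eq_square)
  have "(r (Suc n))\<^sup>2 \<noteq> \<infinity>" for n using suminf_PInfty[of "\<lambda>n. (r (Suc n))\<^sup>2" n] sq True by auto
  then have fin: "r n \<noteq> \<infinity>" if "n \<ge> 1" for n
    using that by (cases n) (auto simp: power2_eq_square)
  have rs: "r n = ereal (s n)" "0 < s n" if "n \<ge> 1" for n
    using fin[OF that] r[OF that] by (cases "r n"; simp add: s)+
  have "summable (\<lambda>n. real_of_ereal ((r (Suc n))\<^sup>2))"
    using sq True by (intro summable_real_of_ereal) auto
  then have "summable (\<lambda>n. (s (Suc n))\<^sup>2)" by (simp add: s power2_eq_square)
  then show thesis using radii rs by blast
next
  case False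
  then show thesis using assms(1) unconstrained unfolding A3_def by blast
qed

lemma log_le_sqrt:
  fixes c \<epsilon> x :: real
  defines "l \<equiv> ln (1 / \<epsilon>)"
  assumes c: "1 \<le> c" and \<epsilon>: "0 < \<epsilon>" and l: "1 \<le> l" and x: "c ^ 4 * (l / \<epsilon>)\<^sup>2 \<le> x"
  shows "c * ln (x + 1) \<le> 8 * \<epsilon> * sqrt x"
proof -
  define t where "t = x / (l / \<epsilon>)\<^sup>2"
  define u where "u = sqrt (sqrt t)"
  have l\<epsilon>: "0 < (l / \<epsilon>)\<^sup>2" using l \<epsilon> by simp
  have t: "c ^ 4 \<le> t" using x l\<epsilon> by (simp add: t_def pos_le_divide_eq)
  then have t0: "0 \<le> t" using c by (meson order_trans zero_le_power zero_le_one)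
  have u4: "u ^ 4 = t"
    using t0 power_mult[of u 2 2] by (simp add: u_def)
  have u0: "0 \<le> u" using t0 by (simp add: u_def)
  have cu: "c \<le> u" using t u0 c by (intro power_le_imp_le_base[of c 3 u]) (simp_all add: u4)
  then have u1: "1 \<le> u" using c by simp
  have xu: "x = u ^ 4 * (l / \<epsilon>)\<^sup>2" using l\<epsilon> by (simp add: u4 t_def)
  have "0 < ln (1 / \<epsilon>)" using l unfolding l_def by linarith
  then have "\<epsilon> < 1" using \<epsilon> by (simp add: ln_div)
  have "1 \<le> l / \<epsilon>" using l \<epsilon> \<open>\<epsilon> < 1\<close> by (simp add: field_simps)
  then have x1: "1 \<le> x" using u1 mult_mono[of 1 "u ^ 4" 1 "(l / \<epsilon>)\<^sup>2"] by (simp add: xu)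
  have sx: "sqrt x = u\<^sup>2 * (l / \<epsilon>)"
    using u0 l \<epsilon> by (intro real_sqrt_unique) (simp_all add: xu power_mult_distrib power_divide)
  have ln_u: "ln u \<le> u - 1" using ln_le_minus_one[of u] u1 by simp
  have l\<epsilon>': "l = - ln \<epsilon>" using \<epsilon> by (simp add: l_def ln_div)
  have "ln (x + 1) \<le> ln (2 * x)" using x1 by simp
  also have "\<dots> = ln 2 + (4 * ln u + 2 * (ln l - ln \<epsilon>))"
    using u1 l \<epsilon> by (simp add: xu ln_mult ln_realpow ln_div)
  also have "\<dots> \<le> 1 + (4 * (u - 1) + 2 * ((l - 1) + l))"
    using l\<epsilon>' ln_u ln_le_minus_one[of l] ln_le_minus_one[of 2] l by simp
  also have "\<dots> \<le> 8 * (u * l)"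
    using mult_nonneg_nonneg[of "u - 1" "l - 1"] u1 l by (simp add: algebra_simps)
  finally have "c * ln (x + 1) \<le> u * (8 * (u * l))"
    using cu c x1 by (intro mult_mono) auto
  also have "\<dots> = 8 * \<epsilon> * sqrt x" using \<epsilon> by (simp add: sx power2_eq_square)
  finally show ?thesis .
qed

section \<open>Complexity and asymptotic stationarity\<close>

lemma ereal_rate_le:
  fixes D w :: ereal
  assumes "0 < c" "0 \<le> w" "0 < q" "0 < D" "D \<le> ereal q" "0 \<le> N" "ereal N \<le> ereal 1 + ereal L + w"
  shows "ereal (c * N / q) \<le> ereal c * (ereal 1 + ereal L + w) / D"
proof -
  obtain \<delta> where \<delta>: "D = ereal \<delta>" "0 < \<delta>" "\<delta> \<le> q" using assms(4,5) by (cases D) auto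
  show ?thesis
  proof (cases w)
    case (real w')
    then have "c * N / q \<le> c * (1 + L + w') / \<delta>"
      using assms \<delta> by (intro frac_le mult_left_mono mult_nonneg_nonneg) auto
    then show ?thesis using real \<delta> by simp
  next
    case PInf
    then show ?thesis using assms(1) \<delta> by simp
  qed (use assms(2) in simp)
qed

lemma iteration_complexity_le:
  assumes "\<And>\<theta> \<Delta>. bmm_dr_output blk m T f p r Lg \<rho> \<theta> \<Delta> \<Longrightarrow> \<theta> 0 \<in> K \<Longrightarrow> (\<Sum>n. \<Delta> (Suc n)) \<le> D \<Longrightarrow>
    \<exists>k\<in>{1..N}. approx_stationary_nash blk m T f p \<epsilon> (\<theta> k)"
    and "real N \<le> c"
  shows "ereal_of_enat (iteration_complexity blk m T f p r Lg \<rho> K D \<epsilon>) \<le> ereal c"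
proof -
  have "iteration_complexity blk m T f p r Lg \<rho> K D \<epsilon> \<le> enat N"
    unfolding iteration_complexity_def
  proof (rule SUP_least, clarify)
    fix \<theta> \<Delta> assume "bmm_dr_output blk m T f p r Lg \<rho> \<theta> \<Delta>" "\<theta> 0 \<in> K" "(\<Sum>n. \<Delta> (Suc n)) \<le> D"
    then obtain k where k: "k \<in> {1..N}" "approx_stationary_nash blk m T f p \<epsilon> (\<theta> k)"
      using assms(1) by blast
    then have "first_hit blk m T f p \<theta> \<epsilon> \<le> enat k"
      unfolding first_hit_def by (intro INF_lower) simp
    then show "first_hit blk m T f p \<theta> \<epsilon> \<le> enat N" using k(1) order_trans by fastforce
  qed
  then have "ereal_of_enat (iteration_complexity blk m T f p r Lg \<rho> K D \<epsilon>) \<le> ereal_of_enat (enat N)"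
    by (simp only: ereal_of_enat_le_iff)
  then show ?thesis using assms(2) order_trans by fastforce
qed

text \<open>By compactness every subsequence of the iterates has a further one with a limit in C,
  where H vanishes by continuity; so the limit lies in S. This contradicts a subsequence that stays
  away from S, and it also shows that S is nonempty.\<close>

lemma converges_to_set_gaps:
  fixes \<theta> :: "nat \<Rightarrow> 'a::metric_space" and H :: "'a \<Rightarrow> real"
  assumes C: "compact C" "range \<theta> \<subseteq> C" and H: "continuous_on C H" "(\<lambda>n. H (\<theta> n)) \<longlonglongrightarrow> 0"
    and S: "\<And>x. x \<in> C \<Longrightarrow> H x \<le> 0 \<Longrightarrow> x \<in> S"
  shows "converges_to_set \<theta> S"
proof -
  have limit: "\<exists>l k. l \<in> S \<and> strict_mono (k :: nat \<Rightarrow> nat) \<and> (\<lambda>n. \<theta> (q (k n))) \<longlonglongrightarrow> l"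
    if q: "strict_mono q" for q :: "nat \<Rightarrow> nat"
  proof -
    obtain l k where l: "l \<in> C" "strict_mono (k :: nat \<Rightarrow> nat)" "((\<lambda>n. \<theta> (q n)) \<circ> k) \<longlonglongrightarrow> l"
    proof (rule seq_compactE)
      show "seq_compact C" using C(1) by (rule compact_imp_seq_compact)
      show "\<forall>n. \<theta> (q n) \<in> C" using C(2) by auto
    qed
    have "(\<lambda>n. H (\<theta> (q (k n)))) \<longlonglongrightarrow> H l"
      using l C(2) by (intro continuous_on_tendsto_compose[OF H(1)]) (auto simp: o_def image_subset_iff)
    moreover have "(\<lambda>n. H (\<theta> (q (k n)))) \<longlonglongrightarrow> 0"
      using LIMSEQ_subseq_LIMSEQ[OF H(2) strict_mono_o[OF q l(2)]] by (simp add: o_def)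
    ultimately have "H l = 0" by (rule LIMSEQ_unique)
    then have "l \<in> S" using S l(1) by simp
    then show ?thesis using l(2,3) unfolding o_def by blast
  qed
  have "(\<lambda>n. infdist (\<theta> n) S) \<longlonglongrightarrow> 0"
  proof (rule ccontr)
    assume "\<not> (\<lambda>n. infdist (\<theta> n) S) \<longlonglongrightarrow> 0"
    then obtain \<epsilon> where \<epsilon>: "0 < \<epsilon>" "\<And>N. \<exists>n\<ge>N. \<epsilon> \<le> infdist (\<theta> n) S"
      unfolding lim_sequentially by (auto simp: not_less infdist_nonneg)
    then have inf: "infinite {n. \<epsilon> \<le> infdist (\<theta> n) S}"
      unfolding infinite_nat_iff_unbounded_le by simp
    obtain q where q: "strict_mono (q :: nat \<Rightarrow> nat)" "\<And>n. \<epsilon> \<le> infdist (\<theta> (q n)) S"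
      using infinite_enumerate[OF inf] by auto
    obtain l k where l: "l \<in> S" "(\<lambda>n. \<theta> (q (k n))) \<longlonglongrightarrow> l" using limit[OF q(1)] by blast
    then obtain n where "dist (\<theta> (q (k n))) l < \<epsilon>" using \<epsilon>(1) by (auto simp: lim_sequentially)
    then show False using infdist_le[OF l(1), of "\<theta> (q (k n))"] q(2)[of "k n"] by simp
  qed
  moreover have "S \<noteq> {}" using limit[of id] by (auto simp: strict_mono_def)
  ultimately show ?thesis by (simp add: converges_to_set_def)
qed

lemma bmm_dr_output_cases:
  fixes s :: "nat \<Rightarrow> real"
  assumes "bmm_dr_output blk m T f p r Lg \<rho> \<theta> \<Delta>" and s: "\<And>n. s n = real_of_ereal (r n)"
  obtains (radii) "\<And>n. n \<ge> 1 \<Longrightarrow> r n = ereal (s n)" "\<And>n. n \<ge> 1 \<Longrightarrow> 0 < s n"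
      "summable (\<lambda>n. (s (Suc n))\<^sup>2)"
    | (unconstrained) "\<And>n. n \<ge> 1 \<Longrightarrow> r n = \<infinity>" "0 < \<rho>"
proof -
  from assms(1) obtain g where A3: "A3 blk m T r Lg \<rho> g" and r: "\<And>n. n \<ge> 1 \<Longrightarrow> 0 < r n"
    unfolding bmm_dr_output_def bmm_dr_def by blast
  show thesis using A3 r s radii unconstrained by (rule radii_cases)
qed

lemma bmm_dr_output_Lg: "bmm_dr_output blk m T f p r Lg \<rho> \<theta> \<Delta> \<Longrightarrow> 0 < Lg"
  unfolding bmm_dr_output_def A3_def by blast

lemma bmm_dr_output_rho: "bmm_dr_output blk m T f p r Lg \<rho> \<theta> \<Delta> \<Longrightarrow> 0 \<le> \<rho>"
  unfolding bmm_dr_output_def A3_def by blast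

context block_problem
begin

lemma approx_stationary_nashI:
  assumes "nash_gap blk m T f p x \<le> ereal h" "h \<le> \<epsilon>" "x \<in> \<Theta>"
  shows "approx_stationary_nash blk m T f p \<epsilon> x"
  using assms order_trans[of "nash_gap blk m T f p x" "ereal h" "ereal \<epsilon>"]
  by (simp add: approx_stationary_nash_def)

lemma rate_of_convergence:
  assumes K: "compact K" "K \<subseteq> \<Theta>"
  shows "\<exists>M>0. \<exists>c>0. \<forall>Lg \<rho> \<theta> \<Delta>.
           bmm_dr_output blk m T f p r Lg \<rho> \<theta> \<Delta> \<and> \<theta> 0 \<in> K \<and> (\<Sum>n. \<Delta> (Suc n)) \<le> D \<longrightarrow>
           (\<forall>n\<ge>2. (MIN k\<in>{1..n}. nash_gap blk m T f p (\<theta> k)) \<le>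
              ereal c * (ereal M + ereal Lg + min (inverse (ereal \<rho>)) (\<Sum>k=1..n. (r k)\<^sup>2))
                / min (ereal (sqrt (real n) / ln (real n))) (\<Sum>k=1..n. r k))"
proof -
  obtain A C H where A: "0 < A"
    and gap: "\<And>x. x \<in> C \<Longrightarrow> nash_gap blk m T f p x \<le> ereal (H x)"
    and run: "\<And>r Lg \<rho> \<theta> \<Delta>. bmm_dr_output blk m T f p r Lg \<rho> \<theta> \<Delta> \<Longrightarrow> \<theta> 0 \<in> K \<Longrightarrow>
       (\<Sum>n. \<Delta> (Suc n)) \<le> D \<Longrightarrow> range \<theta> \<subseteq> C \<and>
       (\<exists>e. descent_data A r Lg \<rho> (\<lambda>n. H (\<theta> n)) e (\<lambda>n. norm (\<theta> (Suc n) - \<theta> n)))"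
    by (rule descent_data_run[OF K, of D]) (rule that)
  define s where "s n = real_of_ereal (r n)" for n
  define S where "S = (\<Sum>n. (s (Suc n))\<^sup>2)"
  define c1 where "c1 = (A\<^sup>2 + A * S + A\<^sup>2 * S) * (1 + S) * ((s 1 + s 2) / s 2)"
  define c2 where "c2 = A + A\<^sup>2 + A ^ 3"
  \<comment> \<open>The maximum with 1 keeps c positive whatever r is. The division by
    \<open>ln 2\<close> pays for the factor \<open>ln n\<close> inserted below for n \<ge>
    2.\<close>
  define c where "c = max 1 (max c1 (c2 / ln 2))"
  have c: "0 < c" "c1 \<le> c" "c2 / ln 2 \<le> c" by (auto simp: c_def)
  have c2: "0 < c2" using A by (simp add: c2_def add_pos_pos)
  have "(MIN k\<in>{1..n}. nash_gap blk m T f p (\<theta> k)) \<le>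
          ereal c * (ereal 1 + ereal Lg + min (inverse (ereal \<rho>)) (\<Sum>k=1..n. (r k)\<^sup>2))
            / min (ereal (sqrt (real n) / ln (real n))) (\<Sum>k=1..n. r k)" (is "?gap \<le> ?rhs")
    if out: "bmm_dr_output blk m T f p r Lg \<rho> \<theta> \<Delta>" "\<theta> 0 \<in> K" "(\<Sum>n. \<Delta> (Suc n)) \<le> D" and n: "2 \<le> n"
    for Lg \<rho> \<theta> \<Delta> n
  proof -
    have Lg: "0 < Lg" by (rule bmm_dr_output_Lg[OF out(1)])
    have \<rho>: "0 \<le> \<rho>" by (rule bmm_dr_output_rho[OF out(1)])
    obtain e where C: "range \<theta> \<subseteq> C"
      and dd: "descent_data A r Lg \<rho> (\<lambda>n. H (\<theta> n)) e (\<lambda>n. norm (\<theta> (Suc n) - \<theta> n))"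
      using run[OF out] by blast
    have le: "?gap \<le> ?rhs" if k: "k \<in> {1..n}" "H (\<theta> k) \<le> x" and x: "ereal x \<le> ?rhs" for k x
    proof -
      have "?gap \<le> nash_gap blk m T f p (\<theta> k)" using k(1) by (intro Min_le) auto
      also have "\<dots> \<le> ereal (H (\<theta> k))" using C by (intro gap) auto
      also have "\<dots> \<le> ereal x" using k(2) by simp
      also note x
      finally show ?thesis .
    qed
    have ln: "0 < ln (real n)" "ln 2 \<le> ln (real n)" using n by auto
    have q: "0 < sqrt (real n) / ln (real n)" using ln n by simp
    have sq: "0 \<le> (r k)\<^sup>2" for k :: nat by (cases "r k") (simp_all add: power2_eq_square)
    have w: "0 \<le> min (inverse (ereal \<rho>)) (\<Sum>k=1..n. (r k)\<^sup>2)"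
      using \<rho> sq by (auto intro!: sum_nonneg)
    from out(1) s_def show ?thesis
    proof (cases rule: bmm_dr_output_cases)
      case r: radii
      let ?R = "\<Sum>k=1..n. s k"
      have "(\<Sum>k=1..n. r k) = (\<Sum>k=1..n. ereal (s k))" using r(1) by (intro sum.cong) auto
      then have R: "(\<Sum>k=1..n. r k) = ereal ?R" by simp
      have R0: "0 < ?R" using n r(2) by (intro sum_pos) auto
      obtain k where k: "k \<in> {1..n}" "H (\<theta> k) \<le> (A\<^sup>2 + A * S + A\<^sup>2 * S) * (1 + Lg) * (1 + S) * ((s 1 + s 2) / s 2) / ?R"
        using rate_radii[OF dd A Lg r n] unfolding S_def by blast
      have "H (\<theta> k) \<le> c1 * (1 + Lg) / ?R" using k(2) by (simp add: c1_def mult_ac)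
      also have "\<dots> \<le> c * (1 + Lg) / ?R"
        using c(2) R0 Lg by (intro divide_right_mono mult_right_mono) auto
      finally have "H (\<theta> k) \<le> c * (1 + Lg) / ?R" .
      moreover have "ereal (c * (1 + Lg) / ?R) \<le> ?rhs"
        using c(1) w R0 q Lg R by (intro ereal_rate_le) (auto intro: add_increasing2)
      ultimately show ?thesis by (rule le[OF k(1)])
    next
      case unconstrained
      let ?Q = "1 + Lg + 1 / \<rho>"
      have "1 \<in> {1..n}" using n by simp
      then have inf: "(\<Sum>k=1..n. r k) = \<infinity>" "(\<Sum>k=1..n. (r k)\<^sup>2) = \<infinity>"
        using unconstrained(1) by (auto simp: sum_Pinfty power2_eq_square)
      have n1: "1 \<le> n" using n by simp
      obtain k where k: "k \<in> {1..n}" "H (\<theta> k) \<le> c2 * sqrt (?Q / n)"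
        using rate_unconstrained[OF dd A unconstrained(2) Lg unconstrained(1) n1] unfolding c2_def by blast
      have Q: "1 \<le> ?Q" using Lg unconstrained(2) by simp
      \<comment> \<open>The rate without radii is stronger than claimed; it is weakened by passing
        from \<open>sqrt ?Q\<close> to \<open>?Q\<close> and inserting \<open>ln n / ln 2\<close>,
        both of which can only increase the bound.\<close>
      have "sqrt ?Q \<le> ?Q" using Q by (intro real_le_lsqrt) (auto simp: power2_eq_square)
      then have "c2 * sqrt ?Q \<le> c2 * ?Q" using c2 by simp
      also have "\<dots> \<le> (c2 / ln 2 * ln n) * ?Q"
        using c2 ln Q by (intro mult_right_mono) (auto simp: field_simps)
      also have "\<dots> \<le> (c * ln n) * ?Q"
        using c(3) ln Q by (intro mult_right_mono) auto
      finally have "c2 * sqrt ?Q / sqrt n \<le> (c * ln n) * ?Q / sqrt n" by (intro divide_right_mono) auto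
      then have "H (\<theta> k) \<le> c * ?Q / (sqrt n / ln n)"
        using k(2) by (simp add: real_sqrt_divide mult_ac)
      moreover have "ereal (c * ?Q / (sqrt n / ln n)) \<le> ?rhs"
      proof (rule ereal_rate_le[OF c(1) w q])
        show "0 < min (ereal (sqrt n / ln n)) (\<Sum>k=1..n. r k)"
          unfolding inf using q by simp
        show "0 \<le> ?Q" using Q by simp
        show "ereal ?Q \<le> ereal 1 + ereal Lg + min (inverse (ereal \<rho>)) (\<Sum>k=1..n. (r k)\<^sup>2)"
          unfolding inf using unconstrained(2) by (simp add: inverse_eq_divide)
      qed simp
      ultimately show ?thesis by (rule le[OF k(1)])
    qed
  qed
  \<comment> \<open>The witness for M is 1.\<close>
  then show ?thesis using c(1) zero_less_one by blast
qed

lemma complexity_unconstrained: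
  assumes K: "compact K" "K \<subseteq> \<Theta>" and r: "\<And>n. n \<ge> 1 \<Longrightarrow> r n = \<infinity>"
  shows "\<exists>C>0. \<forall>\<^sub>F \<epsilon> in at_right 0. \<forall>Lg>0. \<forall>\<rho>>0.
           ereal_of_enat (iteration_complexity blk m T f p r Lg \<rho> K D \<epsilon>)
             \<le> ereal (C * ((1 + Lg + 1 / \<rho>) * (1 / \<epsilon>)\<^sup>2 * (ln (1 / \<epsilon>))\<^sup>2))"
proof -
  obtain A C H where A: "0 < A" and C: "C \<subseteq> \<Theta>"
    and gap: "\<And>x. x \<in> C \<Longrightarrow> nash_gap blk m T f p x \<le> ereal (H x)"
    and run: "\<And>r Lg \<rho> \<theta> \<Delta>. bmm_dr_output blk m T f p r Lg \<rho> \<theta> \<Delta> \<Longrightarrow> \<theta> 0 \<in> K \<Longrightarrow>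
       (\<Sum>n. \<Delta> (Suc n)) \<le> D \<Longrightarrow> range \<theta> \<subseteq> C \<and>
       (\<exists>e. descent_data A r Lg \<rho> (\<lambda>n. H (\<theta> n)) e (\<lambda>n. norm (\<theta> (Suc n) - \<theta> n)))"
    by (rule descent_data_run[OF K, of D]) (rule that)
  define B where "B = A + A\<^sup>2 + A ^ 3"
  have B: "0 < B" using A by (simp add: B_def add_pos_pos)
  have "ereal_of_enat (iteration_complexity blk m T f p r Lg \<rho> K D \<epsilon>)
      \<le> ereal ((B\<^sup>2 + 1) * ((1 + Lg + 1 / \<rho>) * (1 / \<epsilon>)\<^sup>2 * (ln (1 / \<epsilon>))\<^sup>2))"
    if \<epsilon>: "0 < \<epsilon>" "\<epsilon> < exp (- 1)" and Lg: "0 < Lg" and \<rho>: "0 < \<rho>" for \<epsilon> Lg \<rho>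
  proof -
    let ?Q = "1 + Lg + 1 / \<rho>"
    have Q: "1 \<le> ?Q" using Lg \<rho> by simp
    have "\<epsilon> < 1" using \<epsilon>(2) exp_le_one_iff[of "-1::real"] by linarith
    have "ln \<epsilon> < - 1" using \<epsilon> ln_less_cancel_iff[of \<epsilon> "exp (- 1)"] by simp
    then have l: "1 \<le> ln (1 / \<epsilon>)" using \<epsilon> by (simp add: ln_div)
    have pos: "0 < B\<^sup>2 * ?Q / \<epsilon>\<^sup>2" using B Q \<epsilon> by (intro divide_pos_pos mult_pos_pos) auto
    \<comment> \<open>Solves \<open>B * sqrt (?Q / N) \<le> \<epsilon>\<close> for N. Rounding up
      costs at most 1, which is below \<open>?Q / \<epsilon>\<^sup>2\<close>; the logarithmic factor
      is at least 1 because \<epsilon> is below \<open>exp (- 1)\<close>.\<close>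
    obtain N where N: "B\<^sup>2 * ?Q / \<epsilon>\<^sup>2 \<le> real N" "real N \<le> B\<^sup>2 * ?Q / \<epsilon>\<^sup>2 + 1"
      using that[of "nat \<lceil>B\<^sup>2 * ?Q / \<epsilon>\<^sup>2\<rceil>"] pos by linarith
    then have N1: "1 \<le> N" using pos by linarith
    have "\<epsilon>\<^sup>2 \<le> 1" using \<open>\<epsilon> < 1\<close> \<epsilon>(1) by (simp add: power_le_one)
    then have "1 \<le> ?Q / \<epsilon>\<^sup>2" using Q \<epsilon>(1) by simp
    then have "N \<le> B\<^sup>2 * ?Q / \<epsilon>\<^sup>2 + ?Q / \<epsilon>\<^sup>2" using N(2) by linarith
    also have "\<dots> = (B\<^sup>2 + 1) * (?Q / \<epsilon>\<^sup>2)"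
      by (metis distrib_right mult_1 times_divide_eq_right)
    also have "\<dots> \<le> (B\<^sup>2 + 1) * (?Q / \<epsilon>\<^sup>2 * (ln (1 / \<epsilon>))\<^sup>2)"
      using mult_left_mono[OF one_le_power[OF l, of 2], of "?Q / \<epsilon>\<^sup>2"] Q
      by (intro mult_left_mono) auto
    finally have N2: "N \<le> (B\<^sup>2 + 1) * (?Q * (1 / \<epsilon>)\<^sup>2 * (ln (1 / \<epsilon>))\<^sup>2)"
      by (simp add: power_divide)
    have hit: "\<exists>k\<in>{1..N}. approx_stationary_nash blk m T f p \<epsilon> (\<theta> k)"
      if out: "bmm_dr_output blk m T f p r Lg \<rho> \<theta> \<Delta>" "\<theta> 0 \<in> K" "(\<Sum>n. \<Delta> (Suc n)) \<le> D" for \<theta> \<Delta>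
    proof -
      obtain e where \<theta>: "range \<theta> \<subseteq> C"
        and dd: "descent_data A r Lg \<rho> (\<lambda>n. H (\<theta> n)) e (\<lambda>n. norm (\<theta> (Suc n) - \<theta> n))"
        using run[OF out] by blast
      obtain k where k: "k \<in> {1..N}" "H (\<theta> k) \<le> B * sqrt (?Q / N)"
        using rate_unconstrained[OF dd A \<rho> Lg r N1] unfolding B_def by blast
      have "?Q / N \<le> (\<epsilon> / B)\<^sup>2"
        using N(1) N1 B \<epsilon>(1) by (simp add: field_simps)
      then have "sqrt (?Q / N) \<le> \<epsilon> / B" using B \<epsilon>(1) by (intro real_le_lsqrt) auto
      then have "B * sqrt (?Q / N) \<le> \<epsilon>" using B by (simp add: field_simps)
      then show ?thesis
        using k \<theta> C gap by (intro bexI[of _ k] approx_stationary_nashI[of _ "H (\<theta> k)"]) auto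
    qed
    from hit N2 show ?thesis by (rule iteration_complexity_le)
  qed
  moreover have "\<forall>\<^sub>F \<epsilon> in at_right 0. 0 < \<epsilon> \<and> \<epsilon> < exp (- 1 :: real)"
    by (rule eventually_at_rightI[of 0 "exp (- 1)"]) auto
  ultimately have "\<forall>\<^sub>F \<epsilon> in at_right 0. \<forall>Lg>0. \<forall>\<rho>>0.
      ereal_of_enat (iteration_complexity blk m T f p r Lg \<rho> K D \<epsilon>)
        \<le> ereal ((B\<^sup>2 + 1) * ((1 + Lg + 1 / \<rho>) * (1 / \<epsilon>)\<^sup>2 * (ln (1 / \<epsilon>))\<^sup>2))"
    by (auto elim!: eventually_mono)
  moreover have "0 < B\<^sup>2 + 1" by (simp add: add_nonneg_pos)
  ultimately show ?thesis by blast
qed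

lemma complexity_diminishing_radii:
  assumes K: "compact K" "K \<subseteq> \<Theta>" and r1: "r 1 < \<infinity>"
    and r: "\<And>n. n \<ge> 2 \<Longrightarrow> r n = ereal (1 / (sqrt (real n) * ln (real n)))"
  shows "\<exists>C>0. \<forall>\<^sub>F \<epsilon> in at_right 0. \<forall>Lg>0. \<forall>\<rho>\<ge>0.
           ereal_of_enat (iteration_complexity blk m T f p r Lg \<rho> K D \<epsilon>)
             \<le> ereal (C * ((1 + Lg) * (1 / \<epsilon>)\<^sup>2 * (ln (1 / \<epsilon>))\<^sup>2))"
proof -
  obtain A C H where A: "0 < A" and C: "C \<subseteq> \<Theta>"
    and gap: "\<And>x. x \<in> C \<Longrightarrow> nash_gap blk m T f p x \<le> ereal (H x)"
    and run: "\<And>r Lg \<rho> \<theta> \<Delta>. bmm_dr_output blk m T f p r Lg \<rho> \<theta> \<Delta> \<Longrightarrow> \<theta> 0 \<in> K \<Longrightarrow>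
       (\<Sum>n. \<Delta> (Suc n)) \<le> D \<Longrightarrow> range \<theta> \<subseteq> C \<and>
       (\<exists>e. descent_data A r Lg \<rho> (\<lambda>n. H (\<theta> n)) e (\<lambda>n. norm (\<theta> (Suc n) - \<theta> n)))"
    by (rule descent_data_run[OF K, of D]) (rule that)
  define s where "s n = real_of_ereal (r n)" for n
  define X where "X = max 1 (A + A\<^sup>2 + A\<^sup>2 * (\<Sum>n. (s (Suc n))\<^sup>2))"
  \<comment> \<open>16 is 8 * 2: the 8 of \<open>log_le_sqrt\<close>, and 2 from
    \<open>sqrt (N + 1) \<le> 2 * sqrt N\<close>.\<close>
  define c where "c = 16 * X"
  have X: "1 \<le> X" by (simp add: X_def)
  have c: "1 \<le> c" using X by (simp add: c_def)
  have "ereal_of_enat (iteration_complexity blk m T f p r Lg \<rho> K D \<epsilon>)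
      \<le> ereal ((c ^ 4 + 1) * ((1 + Lg) * (1 / \<epsilon>)\<^sup>2 * (ln (1 / \<epsilon>))\<^sup>2))"
    if \<epsilon>: "0 < \<epsilon>" "\<epsilon> < exp (- 1)" and Lg: "0 < Lg" for \<epsilon> Lg \<rho>
  proof -
    let ?l = "ln (1 / \<epsilon>)"
    define N0 where "N0 = (1 + Lg) * (?l / \<epsilon>)\<^sup>2"
    have "\<epsilon> < 1" using \<epsilon>(2) exp_le_one_iff[of "-1::real"] by linarith
    have "ln \<epsilon> < - 1" using \<epsilon> ln_less_cancel_iff[of \<epsilon> "exp (- 1)"] by simp
    then have l: "1 \<le> ?l" using \<epsilon> by (simp add: ln_div)
    have l\<epsilon>: "1 / \<epsilon> \<le> ?l / \<epsilon>" using l \<epsilon> by (intro divide_right_mono) auto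
    have "1 \<le> 1 / \<epsilon>" using \<open>\<epsilon> < 1\<close> \<epsilon>(1) by simp
    then have l1: "1 \<le> (?l / \<epsilon>)\<^sup>2" using l\<epsilon> by (intro one_le_power) simp
    then have N01: "(?l / \<epsilon>)\<^sup>2 \<le> N0" "1 \<le> N0"
      using Lg unfolding N0_def by (auto simp: distrib_right intro: add_increasing2)
    have c4: "1 \<le> c ^ 4" using c by (rule one_le_power)
    have pos: "1 \<le> c ^ 4 * N0" using c4 N01(2) mult_mono[of 1 "c ^ 4" 1 N0] by simp
    obtain N where N: "c ^ 4 * N0 \<le> real N" "real N \<le> c ^ 4 * N0 + 1"
      using that[of "nat \<lceil>c ^ 4 * N0\<rceil>"] pos by linarith
    then have N1: "1 \<le> N" using pos by linarith
    have "N \<le> c ^ 4 * N0 + N0" using N(2) N01(2) by linarith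
    then have "N \<le> (c ^ 4 + 1) * N0" by (simp only: distrib_right mult_1)
    then have N2: "N \<le> (c ^ 4 + 1) * ((1 + Lg) * (1 / \<epsilon>)\<^sup>2 * ?l\<^sup>2)"
      by (simp add: N0_def power_divide mult_ac)
    have hit: "\<exists>k\<in>{1..N}. approx_stationary_nash blk m T f p \<epsilon> (\<theta> k)"
      if out: "bmm_dr_output blk m T f p r Lg \<rho> \<theta> \<Delta>" "\<theta> 0 \<in> K" "(\<Sum>n. \<Delta> (Suc n)) \<le> D" for \<theta> \<Delta>
    proof -
      obtain e where \<theta>: "range \<theta> \<subseteq> C"
        and dd: "descent_data A r Lg \<rho> (\<lambda>n. H (\<theta> n)) e (\<lambda>n. norm (\<theta> (Suc n) - \<theta> n))"
        using run[OF out] by blast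
      from out(1) s_def
      have radii: "(\<forall>n\<ge>1. r n = ereal (s n)) \<and> (\<forall>n\<ge>1. 0 < s n) \<and> summable (\<lambda>n. (s (Suc n))\<^sup>2)"
      proof (cases rule: bmm_dr_output_cases)
        \<comment> \<open>Excluded by the finiteness of the first radius.\<close>
        case unconstrained
        then show ?thesis using r1 unconstrained(1)[of 1] by simp
      qed blast
      then have rs: "\<And>n. n \<ge> 1 \<Longrightarrow> r n = ereal (s n)" "\<And>n. n \<ge> 1 \<Longrightarrow> 0 < s n"
        "summable (\<lambda>n. (s (Suc n))\<^sup>2)" by blast+
      \<comment> \<open>Only radii of index at least 2 limit the weights, and these have the
        prescribed form; the first one does not occur.\<close>
      have s: "s (Suc k) = 1 / (sqrt (real (Suc k)) * ln (real (Suc k)))" if "1 \<le> k" for k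
        using r[of "Suc k"] that by (simp add: s_def)
      define b1 where "b1 = 1 / sqrt (N * (1 + Lg))"
      \<comment> \<open>Here \<open>b1\<close> is the weight that balances the error in
        \<open>Lg\<close>; the cap is the smallest of the radii 2 to N + 1. If \<open>b1\<close> is
        the minimum, the gap is of order \<open>sqrt ((1 + Lg) / N)\<close>; if the cap is, it is of
        order \<open>ln N / sqrt N\<close> without any \<open>Lg\<close>. The horizon N makes both
        at most \<epsilon>.\<close>
      define b where "b = min b1 (s (Suc N))"
      have NL: "0 < N * (1 + Lg)" using N(1) pos Lg by (intro mult_pos_pos) linarith+
      then have b1: "0 < b1" "b1\<^sup>2 * (N * (1 + Lg)) = 1"
        using N1 Lg by (simp_all add: b1_def power_divide)
      have b: "0 < b" using b1 rs(2) by (simp add: b_def)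
      have "b\<^sup>2 \<le> b1\<^sup>2" using b by (intro power_mono) (auto simp: b_def)
      then have "b\<^sup>2 * (N * (1 + Lg)) \<le> b1\<^sup>2 * (N * (1 + Lg))" using NL by (intro mult_right_mono) auto
      then have b2: "b\<^sup>2 * (N * (1 + Lg)) \<le> 1" using b1(2) by simp
      have b3: "b \<le> s (Suc k)" if k: "k \<in> {1..N}" for k
      proof -
        have "s (Suc N) \<le> s (Suc k)"
          unfolding s[OF N1] using k s[of k]
          by (auto intro!: divide_left_mono mult_mono mult_pos_pos)
        then show ?thesis by (simp add: b_def)
      qed
      obtain k where k: "k \<in> {1..N}" "H (\<theta> k) \<le> (A + A\<^sup>2 + A\<^sup>2 * (\<Sum>n. (s (Suc n))\<^sup>2)) / (N * b)"
        using rate_constant_weight[OF dd A Lg rs N1 b b2 b3] by blast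
      have "(A + A\<^sup>2 + A\<^sup>2 * (\<Sum>n. (s (Suc n))\<^sup>2)) / (N * b) \<le> X / (N * b)"
        using b by (intro divide_right_mono) (auto simp: X_def)
      moreover have "X \<le> \<epsilon> * (N * b)"
      proof (cases "b = b1")
        case True
        have "X\<^sup>2 * (1 + Lg) \<le> c ^ 4 * (1 + Lg)"
        proof (rule mult_right_mono)
          have "X\<^sup>2 \<le> c\<^sup>2" using X by (intro power_mono) (auto simp: c_def)
          also have "\<dots> \<le> c ^ 4" using c by (intro power_increasing) auto
          finally show "X\<^sup>2 \<le> c ^ 4" .
        qed (use Lg in simp)
        also have "\<dots> \<le> c ^ 4 * (1 + Lg) * ?l\<^sup>2"
          using mult_left_mono[OF one_le_power[OF l, of 2], of "c ^ 4 * (1 + Lg)"] c4 Lg by simp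
        also have "\<dots> = \<epsilon>\<^sup>2 * (c ^ 4 * N0)"
          using \<epsilon>(1) by (simp add: N0_def power_divide)
        also have "\<dots> \<le> \<epsilon>\<^sup>2 * N" using N(1) by (intro mult_left_mono) auto
        finally have "(X * sqrt (1 + Lg))\<^sup>2 \<le> (\<epsilon> * sqrt N)\<^sup>2"
          using Lg by (simp add: power_mult_distrib)
        then have "X * sqrt (1 + Lg) \<le> \<epsilon> * sqrt N"
          by (rule power2_le_imp_le) (use \<epsilon>(1) in simp)
        moreover have "N * b1 * sqrt (1 + Lg) = sqrt N"
        proof -
          have "N * b1 * sqrt (1 + Lg) = N / sqrt N" using Lg by (simp add: b1_def real_sqrt_mult)
          then show ?thesis by (simp add: real_div_sqrt)
        qed
        ultimately have "X * sqrt (1 + Lg) \<le> \<epsilon> * (N * b1) * sqrt (1 + Lg)"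
          by (simp only: mult.assoc)
        then show ?thesis using Lg True by simp
      next
        case False
        then have bs: "b = s (Suc N)" by (simp add: b_def min_def split: if_splits)
        have "c ^ 4 * (?l / \<epsilon>)\<^sup>2 \<le> N" using N(1) N01(1) c4 mult_left_mono[OF N01(1), of "c ^ 4"] by linarith
        from log_le_sqrt[OF c \<epsilon>(1) l this]
        have ln: "2 * X * ln (N + 1) \<le> \<epsilon> * sqrt N" by (simp add: c_def mult.assoc add.commute)
        have "sqrt (N + 1) \<le> sqrt (4 * N)" using N1 by (intro real_sqrt_le_mono) linarith
        then have sq: "sqrt (N + 1) \<le> 2 * sqrt N" by (simp add: real_sqrt_mult)
        have "X * (sqrt (N + 1) * ln (N + 1)) \<le> X * ((2 * sqrt N) * ln (N + 1))"
          using sq X by (intro mult_left_mono mult_right_mono) auto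
        also have "\<dots> = (2 * X * ln (N + 1)) * sqrt N" by simp
        also have "\<dots> \<le> (\<epsilon> * sqrt N) * sqrt N" using ln by (intro mult_right_mono) auto
        also have "\<dots> = \<epsilon> * N" by simp
        finally have "X * (sqrt (N + 1) * ln (N + 1)) \<le> \<epsilon> * N" .
        moreover have "0 < sqrt (N + 1) * ln (N + 1)" using N1 by (intro mult_pos_pos) auto
        ultimately have "X \<le> \<epsilon> * N / (sqrt (N + 1) * ln (N + 1))" by (simp add: pos_le_divide_eq)
        then show ?thesis unfolding bs s[OF N1] by (simp add: add.commute)
      qed
      then have "X / (N * b) \<le> \<epsilon>" using b N1 by (simp add: pos_divide_le_eq)
      ultimately have "H (\<theta> k) \<le> \<epsilon>" using k(2) by linarith
      then show ?thesis
        using k(1) \<theta> C gap by (intro bexI[of _ k] approx_stationary_nashI[of _ "H (\<theta> k)"]) auto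
    qed
    from hit N2 show ?thesis by (rule iteration_complexity_le)
  qed
  moreover have "\<forall>\<^sub>F \<epsilon> in at_right 0. 0 < \<epsilon> \<and> \<epsilon> < exp (- 1 :: real)"
    by (rule eventually_at_rightI[of 0 "exp (- 1)"]) auto
  ultimately have "\<forall>\<^sub>F \<epsilon> in at_right 0. \<forall>Lg>0. \<forall>\<rho>\<ge>0.
      ereal_of_enat (iteration_complexity blk m T f p r Lg \<rho> K D \<epsilon>)
        \<le> ereal ((c ^ 4 + 1) * ((1 + Lg) * (1 / \<epsilon>)\<^sup>2 * (ln (1 / \<epsilon>))\<^sup>2))"
    by (auto elim!: eventually_mono)
  moreover have "0 < c ^ 4 + 1" using c by (simp add: add_nonneg_pos)
  ultimately show ?thesis by blast
qed

text \<open>Replacing block i changes only the i-th summand of p, so the blockwise differences add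
  up to the full difference \<open>p x - p y\<close>.\<close>

lemma V_tilde_separable:
  assumes p: "\<And>x. x \<in> \<Theta> \<Longrightarrow> p x = (\<Sum>i=1..m. pp i (block blk i x))"
    and x: "x \<in> \<Theta>" and y: "y \<in> \<Theta>"
  shows "V_tilde blk m f p x y = (- grad UNIV f x) \<bullet> (y - x) + p x - p y"
proof -
  have "p x - p (block_upd blk x i y) = pp i (block blk i x) - pp i (block blk i y)"
    if i: "i \<in> {1..m}" for i
  proof -
    have "block_upd blk x i (block blk i y) \<in> \<Theta>"
      using x y i by (intro block_upd_in_prod_set block_set) (auto simp: prod_set_def)
    then have "p (block_upd blk x i y) = (\<Sum>k=1..m. pp k (block blk k (block_upd blk x i y)))"
      using p by simp
    moreover have "block blk k (block_upd blk x i y) = (if k = i then block blk i y else block blk k x)" for k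
      by (auto simp: vec_eq_iff)
    ultimately have "p x - p (block_upd blk x i y) =
        (\<Sum>k=1..m. if k = i then pp i (block blk i x) - pp i (block blk i y) else 0)"
      using p[OF x] by (simp only: sum_subtractf[symmetric]) (intro sum.cong, auto)
    also have "\<dots> = pp i (block blk i x) - pp i (block blk i y)"
      using i by (simp only: sum.delta finite_atLeastAtMost if_True)
    finally show ?thesis .
  qed
  then have "(\<Sum>i=1..m. p x - p (block_upd blk x i y)) = p x - p y"
    using p[OF x] p[OF y] by (simp add: sum_subtractf)
  then show ?thesis by (simp add: V_tilde_def)
qed

lemma stationary_if_separable:
  assumes "\<And>x. x \<in> \<Theta> \<Longrightarrow> p x = (\<Sum>i=1..m. pp i (block blk i x))"
    and "stationary_nash blk m T f p x"
  shows "stationary blk m T f p x"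
proof -
  have x: "x \<in> \<Theta>" using assms(2) by (simp add: stationary_nash_def)
  have "nash_gap blk m T f p x = (SUP y \<in> {y \<in> \<Theta>. norm (y - x) \<le> 1}.
      ereal ((- grad UNIV f x) \<bullet> (y - x) + p x - p y))"
    unfolding nash_gap_def by (intro SUP_cong refl) (simp add: V_tilde_separable[OF assms(1) x])
  then show ?thesis using assms(2) by (simp add: stationary_def stationary_nash_def)
qed

text \<open>S may be any set containing the stationary-Nash points, so that both forms of the
  conclusion are instances. The uniform constants are taken for the single initial point and the
  total gap of the run itself.\<close>

lemma asymptotic_stationarity:
  assumes out: "bmm_dr_output blk m T f p r Lg \<rho> \<theta> \<Delta>" and div: "(\<Sum>n. r (Suc n)) = \<infinity>"
    and S: "\<And>x. stationary_nash blk m T f p x \<Longrightarrow> x \<in> S"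
  shows "converges_to_set \<theta> S"
proof -
  have "compact {\<theta> 0}" "{\<theta> 0} \<subseteq> \<Theta>"
    using out by (auto simp: bmm_dr_output_def bmm_dr_def)
  then obtain A C H where A: "0 < A" and C: "compact C" "C \<subseteq> \<Theta>" and lip: "A-lipschitz_on C H"
    and gap: "\<And>x. x \<in> C \<Longrightarrow> nash_gap blk m T f p x \<le> ereal (H x)"
    and run: "\<And>r Lg \<rho> \<theta>' \<Delta>'. bmm_dr_output blk m T f p r Lg \<rho> \<theta>' \<Delta>' \<Longrightarrow> \<theta>' 0 \<in> {\<theta> 0} \<Longrightarrow>
       (\<Sum>n. \<Delta>' (Suc n)) \<le> (\<Sum>n. \<Delta> (Suc n)) \<Longrightarrow> range \<theta>' \<subseteq> C \<and>
       (\<exists>e. descent_data A r Lg \<rho> (\<lambda>n. H (\<theta>' n)) e (\<lambda>n. norm (\<theta>' (Suc n) - \<theta>' n)))"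
    by (rule descent_data_run[of "{\<theta> 0}" "\<Sum>n. \<Delta> (Suc n)"]) (rule that)
  have "\<theta> 0 \<in> {\<theta> 0}" by simp
  then obtain e where \<theta>: "range \<theta> \<subseteq> C"
    and dd: "descent_data A r Lg \<rho> (\<lambda>n. H (\<theta> n)) e (\<lambda>n. norm (\<theta> (Suc n) - \<theta> n))"
    using run[OF out] by blast
  have Lg: "0 < Lg" by (rule bmm_dr_output_Lg[OF out])
  define s where "s n = real_of_ereal (r n)" for n
  have "(\<lambda>n. H (\<theta> n)) \<longlonglongrightarrow> 0"
    using out s_def
  proof (cases rule: bmm_dr_output_cases)
    case radii
    \<comment> \<open>Finite positive radii whose extended-real sum is infinite cannot be summable
      as real numbers.\<close>
    have "\<not> summable (\<lambda>n. s (Suc n))"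
    proof
      assume "summable (\<lambda>n. s (Suc n))"
      then have "(\<lambda>n. ereal (s (Suc n))) sums ereal (\<Sum>n. s (Suc n))"
        unfolding sums_ereal by (rule summable_sums)
      then show False using div radii(1) by (simp add: sums_iff)
    qed
    moreover have "\<bar>H (\<theta> (Suc n)) - H (\<theta> n)\<bar> \<le> A * norm (\<theta> (Suc n) - \<theta> n)" for n
      using lipschitz_onD[OF lip, of "\<theta> (Suc n)" "\<theta> n"] \<theta> by (auto simp: dist_norm)
    ultimately show ?thesis by (intro gaps_tendsto_zero_radii[OF dd A Lg radii])
  next
    case unconstrained
    then show ?thesis by (intro gaps_tendsto_zero_unconstrained[OF dd A _ Lg])
  qed
  moreover have "x \<in> S" if "x \<in> C" "H x \<le> 0" for x
  proof (rule S)
    have "nash_gap blk m T f p x \<le> ereal 0"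
      using gap[OF that(1)] that(2) order_trans by (metis ereal_less_eq(3))
    then show "stationary_nash blk m T f p x"
      using that(1) C(2) by (auto simp: stationary_nash_def zero_ereal_def)
  qed
  ultimately show ?thesis
    using C(1) \<theta> lipschitz_on_continuous_on[OF lip] by (intro converges_to_set_gaps)
qed

end

theorem theorem2p1:
  fixes blk :: "'n::finite \<Rightarrow> nat" and m :: nat
    and T :: "nat \<Rightarrow> (real ^ 'n) set" and f p :: "real ^ 'n \<Rightarrow> real"
  assumes "range blk = {1..m}"
    and "A1 blk m T"
    and "A2 blk m T f p"
  shows
    \<comment> \<open>(i) rate of convergence\<close>
    "(\<forall>r K D. compact K \<and> K \<subseteq> prod_set blk m T \<longrightarrow>
        (\<exists>M>0. \<exists>c>0. \<forall>Lg \<rho> \<theta> \<Delta>.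
           bmm_dr_output blk m T f p r Lg \<rho> \<theta> \<Delta> \<and> \<theta> 0 \<in> K \<and> (\<Sum>n. \<Delta> (Suc n)) \<le> D \<longrightarrow>
           (\<forall>n\<ge>2. (MIN k\<in>{1..n}. nash_gap blk m T f p (\<theta> k)) \<le>
              ereal c * (ereal M + ereal Lg + min (inverse (ereal \<rho>)) (\<Sum>k=1..n. (r k)\<^sup>2))
                / min (ereal (sqrt (real n) / ln (real n))) (\<Sum>k=1..n. r k))))
    \<comment> \<open>(ii) worst-case iteration complexity\<close>
   \<and> (\<forall>r K D. compact K \<and> K \<subseteq> prod_set blk m T \<and> (\<forall>n\<ge>1. r n = \<infinity>) \<longrightarrow>
        (\<exists>C>0. \<forall>\<^sub>F \<epsilon> in at_right 0. \<forall>Lg>0. \<forall>\<rho>>0.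
           ereal_of_enat (iteration_complexity blk m T f p r Lg \<rho> K D \<epsilon>)
             \<le> ereal (C * ((1 + Lg + 1 / \<rho>) * (1 / \<epsilon>)\<^sup>2 * (ln (1 / \<epsilon>))\<^sup>2))))
   \<and> (\<forall>r K D. compact K \<and> K \<subseteq> prod_set blk m T \<and> 0 < r 1 \<and> r 1 < \<infinity> \<and>
          (\<forall>n\<ge>2. r n = ereal (1 / (sqrt (real n) * ln (real n)))) \<longrightarrow>
        (\<exists>C>0. \<forall>\<^sub>F \<epsilon> in at_right 0. \<forall>Lg>0. \<forall>\<rho>\<ge>0.
           ereal_of_enat (iteration_complexity blk m T f p r Lg \<rho> K D \<epsilon>)
             \<le> ereal (C * ((1 + Lg) * (1 / \<epsilon>)\<^sup>2 * (ln (1 / \<epsilon>))\<^sup>2))))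
    \<comment> \<open>(iii) asymptotic stationarity\<close>
   \<and> (\<forall>r Lg \<rho> \<theta> \<Delta>. bmm_dr_output blk m T f p r Lg \<rho> \<theta> \<Delta> \<and> (\<Sum>n. r (Suc n)) = \<infinity> \<longrightarrow>
        converges_to_set \<theta> {x. stationary_nash blk m T f p x} \<and>
        ((\<exists>pp. (\<forall>i\<in>{1..m}. convex_on (T i) (pp i)) \<and>
               (\<forall>x\<in>prod_set blk m T. p x = (\<Sum>i=1..m. pp i (block blk i x)))) \<longrightarrow>
         converges_to_set \<theta> {x. stationary blk m T f p x}))"
proof -
  interpret block_problem blk m T f p
    using assms by unfold_locales
  show ?thesis
  proof (intro conjI allI impI; (elim conjE exE)?)
    fix r K D assume "compact K" "K \<subseteq> \<Theta>"
    then show "\<exists>M>0. \<exists>c>0. \<forall>Lg \<rho> \<theta> \<Delta>.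
           bmm_dr_output blk m T f p r Lg \<rho> \<theta> \<Delta> \<and> \<theta> 0 \<in> K \<and> (\<Sum>n. \<Delta> (Suc n)) \<le> D \<longrightarrow>
           (\<forall>n\<ge>2. (MIN k\<in>{1..n}. nash_gap blk m T f p (\<theta> k)) \<le>
              ereal c * (ereal M + ereal Lg + min (inverse (ereal \<rho>)) (\<Sum>k=1..n. (r k)\<^sup>2))
                / min (ereal (sqrt (real n) / ln (real n))) (\<Sum>k=1..n. r k))"
      by (rule rate_of_convergence)
  next
    fix r :: "nat \<Rightarrow> ereal" and K D assume "compact K" "K \<subseteq> \<Theta>" "\<forall>n\<ge>1. r n = \<infinity>"
    then show "\<exists>C>0. \<forall>\<^sub>F \<epsilon> in at_right 0. \<forall>Lg>0. \<forall>\<rho>>0.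
           ereal_of_enat (iteration_complexity blk m T f p r Lg \<rho> K D \<epsilon>)
             \<le> ereal (C * ((1 + Lg + 1 / \<rho>) * (1 / \<epsilon>)\<^sup>2 * (ln (1 / \<epsilon>))\<^sup>2))"
      by (intro complexity_unconstrained) auto
  next
    fix r :: "nat \<Rightarrow> ereal" and K D assume "compact K" "K \<subseteq> \<Theta>" "r 1 < \<infinity>"
      "\<forall>n\<ge>2. r n = ereal (1 / (sqrt (real n) * ln (real n)))"
    then show "\<exists>C>0. \<forall>\<^sub>F \<epsilon> in at_right 0. \<forall>Lg>0. \<forall>\<rho>\<ge>0.
           ereal_of_enat (iteration_complexity blk m T f p r Lg \<rho> K D \<epsilon>)
             \<le> ereal (C * ((1 + Lg) * (1 / \<epsilon>)\<^sup>2 * (ln (1 / \<epsilon>))\<^sup>2))"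
      by (intro complexity_diminishing_radii) auto
  next
    fix r Lg \<rho> \<theta> \<Delta>
    assume "bmm_dr_output blk m T f p r Lg \<rho> \<theta> \<Delta>" "(\<Sum>n. r (Suc n)) = \<infinity>"
    note conv = asymptotic_stationarity[OF this]
    show "converges_to_set \<theta> {x. stationary_nash blk m T f p x}" by (intro conv) simp
    fix pp
    assume "\<forall>x\<in>\<Theta>. p x = (\<Sum>i=1..m. pp i (block blk i x))"
    then show "converges_to_set \<theta> {x. stationary blk m T f p x}"
      by (intro conv CollectI stationary_if_separable[of pp]) auto
  qed
qed

end
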